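(* Let $H\in(0,1)$ and let $h$ be a positive function slowly varying at $+\infty$ such that $\mathbf{Var}(S_n)=h^2(n)n^{2H}$ for all $n\ge1$. Then, as $n\to\infty$: 1) if $M\in\mathcal{R}_\nu$ with $\nu>0$, then $$\mathbf{Var}(R_n)\sim\mathbf{Var}(Z_{\nu,H}(1))\,M^2(n)h^2(n)n^{2H};$$ 2) if $M\in\mathcal{R}_0$, then $$\mathbf{Var}(R_n)\sim\left(1-\frac{M(0)}{M(+\infty)}\right)^2M^2(n)h^2(n)n^{2H}.$$
   Context: Setting. $\{\xi_k;\,k\in\mathbb{Z}\}$ are i.i.d. real random variables with mean zero and variance one; $\{a_k;\,k\in\mathbb{Z}\}$ is a nonrandom square summable sequence of real numbers; $X_j=\sum_{k=-\infty}^{\infty}a_{j-k}\xi_k$ for $j\in\mathbb{Z}$; $S_0=0$ and $S_n=\sum_{i=1}^nX_i$ for $n\ge1$. A function $g$ is slowly varying at $+\infty$ if $g(cx)/g(x)\to1$ as $x\to+\infty$ for every $c>0$. For $\nu\ge0$, $\mathcal{R}_\nu$ is the class of non-constant functions $M$ on $[0,+\infty)$ of the form $M(t)=l(t)t^\nu$, where $l$ is non-negative, non-decreasing on $[0,+\infty)$ and slowly varying at $+\infty$ (with the convention $0^0=1$). $M(+\infty)=\lim_{t\to+\infty}M(t)\in(0,+\infty]$, and $M(0)/M(+\infty)=0$ if $M(+\infty)=+\infty$. Put $\Delta M(i)=M(i+1)-M(i)$, $v_0=0$, $v_k=\sum_{i=0}^{k-1}X_{k-i}\Delta M(i)$ for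 $k\ge1$, and $R_n=\sum_{k=0}^nv_k$ for $n\ge0$. $B_H$ is fractional Brownian motion: the centered Gaussian process with continuous paths and covariance $\frac12(t^{2H}+s^{2H}-|t-s|^{2H})$. For $\nu>0$, $Z_{\nu,H}(t)=\nu\int_0^tB_H(t-s)s^{\nu-1}\,ds$. The notation $x_n\sim y_n$ means $x_n/y_n\to1$. *)

theory Defs
  imports "HOL-Probability.Probability"
begin

definition slowly_varying :: "(real \<Rightarrow> real) \<Rightarrow> bool" where
  "slowly_varying g \<longleftrightarrow> (\<forall>c>0. ((\<lambda>x. g (c * x) / g x) \<longlongrightarrow> 1) at_top)"

(* Real powers of t \<ge> 0 with the convention 0^0 = 1; the library has 0 powr 0 = 0. *)
definition pow0 :: "real \<Rightarrow> real \<Rightarrow> real" where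
  "pow0 t \<nu> = (if \<nu> = 0 then 1 else t powr \<nu>)"

(* Functions on [0, \<infinity>) are rendered as total functions of which only the values on {0..} matter. *)
definition R_class :: "real \<Rightarrow> (real \<Rightarrow> real) set" where
  "R_class \<nu> = {M. \<not> M constant_on {0..} \<and>
     (\<exists>l. (\<forall>t\<ge>0. 0 \<le> l t) \<and> mono_on {0..} l \<and> slowly_varying l \<and>
          (\<forall>t\<ge>0. M t = l t * pow0 t \<nu>))}"

definition at_infty :: "(real \<Rightarrow> real) \<Rightarrow> ereal" where
  "at_infty M = Lim at_top (\<lambda>t. ereal (M t))"

(* M(0) / M(+\<infinity>); division in ereal makes this 0 when M(+\<infinity>) = \<infinity>. *)
definition end_ratio :: "(real \<Rightarrow> real) \<Rightarrow> real" where
  "end_ratio M = real_of_ereal (ereal (M 0) / at_infty M)"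

(* The series of the random variables f k, k \<in> I, converges to Y in mean square.
   Square integrability of Y is required because the Bochner integral of a
   non-integrable function is 0. *)
definition has_L2_sum ::
    "'a measure \<Rightarrow> ('i \<Rightarrow> 'a \<Rightarrow> real) \<Rightarrow> ('a \<Rightarrow> real) \<Rightarrow> 'i set \<Rightarrow> bool" where
  "has_L2_sum P f Y I \<longleftrightarrow>
     (\<forall>k\<in>I. f k \<in> borel_measurable P \<and> integrable P (\<lambda>\<omega>. (f k \<omega>)\<^sup>2)) \<and>
     Y \<in> borel_measurable P \<and> integrable P (\<lambda>\<omega>. (Y \<omega>)\<^sup>2) \<and>
     ((\<lambda>F. \<integral>\<omega>. (Y \<omega> - (\<Sum>k\<in>F. f k \<omega>))\<^sup>2 \<partial>P) \<longlongrightarrow> 0) (finite_subsets_at_top I)"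

definition S_sum :: "(int \<Rightarrow> 'a \<Rightarrow> real) \<Rightarrow> nat \<Rightarrow> 'a \<Rightarrow> real" where
  "S_sum X n \<omega> = (\<Sum>i=1..n. X (int i) \<omega>)"

definition Delta :: "(real \<Rightarrow> real) \<Rightarrow> nat \<Rightarrow> real" where
  "Delta M i = M (real i + 1) - M (real i)"

definition v_term :: "(int \<Rightarrow> 'a \<Rightarrow> real) \<Rightarrow> (real \<Rightarrow> real) \<Rightarrow> nat \<Rightarrow> 'a \<Rightarrow> real" where
  "v_term X M k \<omega> = (\<Sum>i<k. X (int k - int i) \<omega> * Delta M i)"

definition R_sum :: "(int \<Rightarrow> 'a \<Rightarrow> real) \<Rightarrow> (real \<Rightarrow> real) \<Rightarrow> nat \<Rightarrow> 'a \<Rightarrow> real" where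
  "R_sum X M n \<omega> = (\<Sum>k=0..n. v_term X M k \<omega>)"

(* Normal law, point masses included. *)
definition gaussian_rv :: "'b measure \<Rightarrow> ('b \<Rightarrow> real) \<Rightarrow> bool" where
  "gaussian_rv Q Y \<longleftrightarrow> Y \<in> borel_measurable Q \<and>
     ((\<exists>\<mu>. AE \<omega> in Q. Y \<omega> = \<mu>) \<or>
      (\<exists>\<mu> \<sigma>. 0 < \<sigma> \<and> distributed Q lborel Y (normal_density \<mu> \<sigma>)))"

definition gaussian_process :: "'b measure \<Rightarrow> 't set \<Rightarrow> ('t \<Rightarrow> 'b \<Rightarrow> real) \<Rightarrow> bool" where
  "gaussian_process Q I B \<longleftrightarrow>
     (\<forall>T c. finite T \<and> T \<subseteq> I \<longrightarrow> gaussian_rv Q (\<lambda>\<omega>. \<Sum>t\<in>T. c t * B t \<omega>))"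

definition fractional_brownian_motion ::
    "real \<Rightarrow> 'b measure \<Rightarrow> (real \<Rightarrow> 'b \<Rightarrow> real) \<Rightarrow> bool" where
  "fractional_brownian_motion H Q B \<longleftrightarrow>
     prob_space Q \<and> gaussian_process Q {0..} B \<and>
     (\<forall>\<omega>\<in>space Q. continuous_on {0..} (\<lambda>t. B t \<omega>)) \<and>
     (\<forall>t\<ge>0. prob_space.expectation Q (B t) = 0) \<and>
     (\<forall>s\<ge>0. \<forall>t\<ge>0. prob_space.expectation Q (\<lambda>\<omega>. B s \<omega> * B t \<omega>) =
        (t powr (2 * H) + s powr (2 * H) - \<bar>t - s\<bar> powr (2 * H)) / 2)"

definition Z_proc :: "real \<Rightarrow> (real \<Rightarrow> 'b \<Rightarrow> real) \<Rightarrow> real \<Rightarrow> 'b \<Rightarrow> real" where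
  "Z_proc \<nu> B t \<omega> = \<nu> * (LINT s:{0..t}|lborel. B (t - s) \<omega> * s powr (\<nu> - 1))"

end

theory Submission
  imports Defs
begin

text \<open>
  Write \<open>\<sigma>(n)\<^sup>2 = Var(S\<^sub>n) = h(n)\<^sup>2 n\<^bsup>2H\<^esup>\<close>. Summation by parts turns \<open>R\<^sub>n\<close> into
  \<open>\<Sum>i<n. \<Delta>M(i) S\<^bsub>n-i\<^esub>\<close>, and stationarity of \<open>X\<close> expresses every covariance of the partial sums
  through \<open>\<sigma>\<close> alone. Hence \<open>Var(R\<^sub>n) / (M(n)\<^sup>2 \<sigma>(n)\<^sup>2)\<close> is a double sum with weights
  \<open>\<Delta>M(i) / M(n)\<close> at the lattice points \<open>i/n\<close> and with kernel
  \<open>(\<sigma>(n-i)\<^sup>2 + \<sigma>(n-j)\<^sup>2 - \<sigma>(\<bar>i-j\<bar>)\<^sup>2) / (2 \<sigma>(n)\<^sup>2)\<close>. Two limits are taken at the same time.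

  The kernel converges uniformly to the covariance of \<open>B\<^sub>H(1-s)\<close> and \<open>B\<^sub>H(1-t)\<close>
  (\<open>uniform_regular_variation\<close>). No measurability of \<open>h\<close> is assumed, so the uniform convergence theorem for regularly varying
  functions cannot be cited; the uniformity comes instead from the inequality
  \<open>\<bar>\<sigma>(m+k) - \<sigma>(m)\<bar> \<le> \<sigma>(k)\<close>, which is the triangle inequality in \<open>L\<^sup>2\<close>.

  The weights converge weakly as measures on \<open>[0,1]\<close> (\<open>R_class_block_limit\<close>): for \<open>\<nu> > 0\<close> to the law with
  density \<open>\<nu> s\<^bsup>\<nu>-1\<^esup>\<close>, and for \<open>\<nu> = 0\<close> to the mass \<open>1 - M(0)/M(\<infinity>)\<close> at \<open>0\<close>, where the kernel
  equals \<open>1\<close>. Cutting \<open>[0,1]\<close> into finitely many blocks shows that the double sums converge to the double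
  integral of the limit kernel (\<open>block_double_sum_limit\<close>). For \<open>\<nu> > 0\<close> that double integral is
  \<open>Var(Z\<^bsub>\<nu>,H\<^esub>(1))\<close> by Fubini's theorem (\<open>variance_Z_proc\<close>). It is not zero because the kernel is
  positive inside the unit square, for every \<open>H\<close>.
\<close>

section \<open>Regular variation of subadditive sequences\<close>

lemma abs_powr_diff_le_one:
  fixes x y H :: real
  assumes "0 < H" "H \<le> 1" "0 \<le> x" "x \<le> y" "y \<le> x + 1"
  shows "\<bar>y powr H - x powr H\<bar> \<le> 1"
proof (cases "y \<le> 1")
  case True
  have "0 \<le> x powr H" "x powr H \<le> y powr H" "y powr H \<le> 1"
    using assms True by (auto intro!: powr_mono2 powr_le1)
  then show ?thesis by linarith
next
  case False
  \<comment> \<open>raising the exponent from \<open>H\<close> to 1 increases a base above 1 and decreases a base below 1\<close>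
  have "y powr H - x powr H = y powr H * (1 - (x / y) powr H)"
    using False assms by (simp add: powr_divide field_simps)
  also have "\<dots> \<le> y powr 1 * (1 - (x / y) powr 1)"
    using False assms by (intro mult_mono diff_left_mono powr_mono powr_mono' ) (auto simp: powr_le1)
  also have "\<dots> = y - x" using False assms by (simp add: field_simps)
  finally have "y powr H - x powr H \<le> 1" using assms by linarith
  moreover have "x powr H \<le> y powr H" using assms by (auto intro!: powr_mono2)
  ultimately show ?thesis by simp
qed

lemma exists_nat_powr_greater:
  fixes B H :: real
  assumes "0 < H"
  shows "\<exists>n::nat. 2 \<le> n \<and> B < real n powr H"
proof -
  obtain n :: nat where n: "max 2 ((\<bar>B\<bar> + 1) powr (1 / H)) < real n" using reals_Archimedean2 by blast
  have "B < ((\<bar>B\<bar> + 1) powr (1 / H)) powr H" using assms by (simp add: powr_powr)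
  also have "\<dots> \<le> real n powr H" using n assms by (intro powr_mono2) auto
  finally show ?thesis using n by (intro exI[of _ n]) auto
qed

text \<open>
  Quotients of two quantities that are known up to the same additive error \<open>b\<close>. The bound is uniform in
  the numerator as long as it does not exceed the denominator, and it tends to \<open>0\<close> as \<open>y\<close> grows.
\<close>
lemma ratio_perturbation:
  fixes p q x y b :: real
  assumes "\<bar>p - x\<bar> \<le> b" "\<bar>q - y\<bar> \<le> b" "0 \<le> x" "x \<le> y" "b < y"
  shows "\<bar>p / q - x / y\<bar> \<le> 2 * b / (y - b)"
proof -
  have b: "0 \<le> b" using assms by linarith
  have q: "0 < y - b" "y - b \<le> q" using assms by linarith+
  have y: "0 < y" using q b by linarith
  have "p / q - x / y = ((p - x) + (x / y) * (y - q)) / q"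
    using q y by (simp add: field_simps)
  also have "\<bar>\<dots>\<bar> \<le> (b + 1 * b) / q"
  proof -
    have "\<bar>(x / y) * (y - q)\<bar> \<le> 1 * b"
      unfolding abs_mult using assms y by (intro mult_mono) (auto simp: abs_minus_commute)
    then have "\<bar>(p - x) + (x / y) * (y - q)\<bar> \<le> b + 1 * b" 
      by (intro order_trans[OF abs_triangle_ineq] add_mono assms(1))
    then show ?thesis using q by (simp add: divide_right_mono)
  qed
  also have "\<dots> \<le> 2 * b / (y - b)"
    using q b by (simp add: frac_le)
  finally show ?thesis .
qed

text \<open>
  Regular variation along integer dilations, together with the increment bound, already gives uniform
  convergence. Fix an integer \<open>K\<close> with \<open>K\<^bsup>H\<^esup> > 2\<close>. Subadditivity gives
  \<open>max\<^bsub>r \<le> K^(j+1)\<^esub> s(r) \<le> K s(K\<^bsup>j\<^esup>) + max\<^bsub>r \<le> K^j\<^esub> s(r)\<close>, and \<open>s(K\<^bsup>j+1\<^esup>) \<ge> 2 s(K\<^bsup>j\<^esup>)\<close> for large \<open>j\<close>, so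
  \<open>max\<^bsub>r \<le> K^j\<^esub> s(r) \<le> C s(K\<^bsup>j\<^esup>)\<close> with a constant \<open>C\<close>. Therefore \<open>s(m) / s(K\<^bsup>j\<^esup>)\<close> differs from
  \<open>(m / K\<^bsup>j\<^esup>)\<^bsup>H\<^esup>\<close> by at most \<open>C + 2\<close> on a range of \<open>m\<close> that is a fixed multiple of \<open>K\<^bsup>j\<^esup>\<close>: compare \<open>m\<close>
  with the multiple of \<open>K\<^bsup>j\<^esup>\<close> below it. If \<open>n\<close> is at least a large multiple \<open>N\<close> of \<open>K\<^bsup>j\<^esup>\<close>, this bounded
  error is negligible in the quotient \<open>s(r) / s(n)\<close>.
\<close>
lemma uniform_regular_variation:
  fixes s :: "nat \<Rightarrow> real"
  assumes H: "0 < H" "H \<le> 1"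
    and zero: "s 0 = 0"
    and pos: "\<And>n. 0 < n \<Longrightarrow> 0 < s n"
    and incr: "\<And>m k. \<bar>s (m + k) - s m\<bar> \<le> s k"
    and ratio: "\<And>c. 0 < c \<Longrightarrow> (\<lambda>n. s (c * n) / s n) \<longlonglongrightarrow> real c powr H"
    and "0 < \<epsilon>"
  shows "\<forall>\<^sub>F n in sequentially. \<forall>r\<le>n. \<bar>s r / s n - (real r / real n) powr H\<bar> \<le> \<epsilon>"
proof -
  have nn: "0 \<le> s n" for n using pos[of n] zero by (cases "n = 0") auto
  have sub: "s (m + k) \<le> s m + s k" for m k using incr[of m k] by linarith
  have mult: "s (k * n) \<le> real k * s n" for k n
  proof (induction k)
    case (Suc k)
    then show ?case using sub[of n "k * n"] by (simp add: algebra_simps)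
  qed (simp add: zero)
  obtain K where K: "2 < real K powr H" "2 \<le> K"
    using exists_nat_powr_greater[OF H(1), of 2] by blast
  have "\<forall>\<^sub>F n in sequentially. 2 < s (K * n) / s n"
    using order_tendstoD(1)[OF ratio[of K] K(1)] K(2) by simp
  then obtain n0 where n0: "\<And>n. n \<ge> n0 \<Longrightarrow> 2 < s (K * n) / s n"
    by (auto simp: eventually_sequentially)
  have expo: "n \<le> K ^ n" for n using K(2) by (metis less_exp less_imp_le power_mono order_trans zero_le)
  have Kpos: "0 < K ^ j" for j using K(2) by simp
  define C where "C = real K + (\<Sum>r\<le>K ^ n0. s r) / s (K ^ n0)"
  \<comment> \<open>the bound with constant \<open>C\<close> reproduces itself from \<open>j\<close> to \<open>j + 1\<close> because \<open>K \<le> C\<close> and \<open>s\<close> at least doubles\<close>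
  have dom: "s r \<le> C * s (K ^ j)" if "j \<ge> n0" "r \<le> K ^ j" for j r
    using that
  proof (induction j arbitrary: r rule: dec_induct)
    case base
    have "s r \<le> (\<Sum>r\<le>K ^ n0. s r)"
      using base nn by (intro member_le_sum) auto
    also have "\<dots> \<le> C * s (K ^ n0)"
      using pos[OF Kpos[of n0]] by (simp add: C_def algebra_simps)
    finally show ?case .
  next
    case (step j)
    let ?n = "K ^ j"
    have sn: "0 < s ?n" using pos[OF Kpos[of j]] .
    have CK: "real K \<le> C" using nn by (auto simp: C_def intro!: divide_nonneg_nonneg sum_nonneg)
    have "r div ?n \<le> K" 
      using step.prems Kpos[of j] by (metis div_le_mono nonzero_mult_div_cancel_right not_gr_zero power_Suc)
    have "s r = s ((r div ?n) * ?n + r mod ?n)" by (simp only: div_mult_mod_eq)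
    also have "\<dots> \<le> s ((r div ?n) * ?n) + s (r mod ?n)" by (rule sub)
    also have "\<dots> \<le> real (r div ?n) * s ?n + C * s ?n"
      using mult step.IH[of "r mod ?n"] Kpos[of j] by (intro add_mono) (auto simp: less_imp_le)
    also have "\<dots> \<le> C * s ?n + C * s ?n"
      using \<open>r div ?n \<le> K\<close> CK sn by (intro add_mono mult_right_mono) auto
    also have "\<dots> = C * (2 * s ?n)" by simp
    also have "\<dots> \<le> C * s (K ^ Suc j)"
      using n0[of "K ^ j"] expo[of j] step.hyps sn CK K(2)
      by (intro mult_left_mono) (auto simp: field_simps)
    finally show ?case .
  qed
  have C0: "0 \<le> C" using nn by (auto simp: C_def intro!: divide_nonneg_nonneg sum_nonneg add_nonneg_nonneg)
  \<comment> \<open>of the additive error, \<open>C\<close> comes from passing to a multiple of \<open>K ^ j\<close>, 1 from the ratio limit, 1 from rounding in the power\<close>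
  define b where "b = C + 2"
  have b: "2 \<le> b" using C0 by (simp add: b_def)
  obtain N where N: "b + 2 * b / \<epsilon> < real N powr H" "1 \<le> N"
    using exists_nat_powr_greater[OF H(1), of "b + 2 * b / \<epsilon>"] by (metis one_le_numeral order_trans)
  have "\<forall>\<^sub>F n in sequentially. \<forall>k\<in>{1..K * N}. \<bar>s (k * n) / s n - real k powr H\<bar> < 1"
    using ratio by (intro eventually_ball_finite) (auto simp: tendsto_iff dist_real_def)
  then obtain n1 where n1: "\<And>n k. n \<ge> n1 \<Longrightarrow> k \<in> {1..K * N} \<Longrightarrow> \<bar>s (k * n) / s n - real k powr H\<bar> < 1"
    unfolding eventually_sequentially by blast
  have near: "\<bar>s m / s (K ^ j) - (real m / real (K ^ j)) powr H\<bar> \<le> b"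
    if j: "j \<ge> max n0 n1" and m: "m \<le> K * N * K ^ j" for j m
  proof -
    let ?n = "K ^ j"
    let ?k = "m div ?n"
    have n: "0 < s ?n" "0 < real ?n" using pos[OF Kpos[of j]] Kpos[of j] by auto
    have k: "?k \<le> K * N"
      using m Kpos[of j] by (metis div_le_mono nonzero_mult_div_cancel_right not_gr_zero)
    have "\<bar>s (?k * ?n + m mod ?n) - s (?k * ?n)\<bar> \<le> s (m mod ?n)" by (rule incr)
    also have "\<dots> \<le> C * s ?n" using dom[of j "m mod ?n"] j Kpos[of j] by (auto simp: less_imp_le)
    finally have "\<bar>s m - s (?k * ?n)\<bar> / s ?n \<le> C" using n by (simp add: field_simps)
    then have 1: "\<bar>s m / s ?n - s (?k * ?n) / s ?n\<bar> \<le> C"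
      using n by (simp add: diff_divide_distrib[symmetric])
    have 2: "\<bar>s (?k * ?n) / s ?n - real ?k powr H\<bar> \<le> 1"
    proof (cases "?k = 0")
      case True
      then show ?thesis using H zero by simp
    next
      case False
      then show ?thesis using n1[of ?n ?k] expo[of j] j k by (auto simp: less_imp_le)
    qed
    have "real m = real ?k * real ?n + real (m mod ?n)"
      by (metis of_nat_add of_nat_mult div_mult_mod_eq)
    moreover have "real (m mod ?n) < real ?n" using Kpos[of j] by (subst of_nat_less_iff) auto
    ultimately have "real ?k \<le> real m / real ?n" "real m / real ?n \<le> real ?k + 1"
      using n by (auto simp: field_simps simp del: of_nat_power)
    then have 3: "\<bar>(real m / real ?n) powr H - real ?k powr H\<bar> \<le> 1"
      using H by (intro abs_powr_diff_le_one) auto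
    show ?thesis using 1 2 3 unfolding b_def by linarith
  qed
  show ?thesis
  proof (rule eventually_sequentiallyI[of "N * K ^ max n0 n1"], intro allI impI)
    fix n r assume n: "N * K ^ max n0 n1 \<le> n" and r: "r \<le> n"
    \<comment> \<open>the base \<open>K ^ j\<close> for which \<open>n\<close> lies between \<open>N\<close> and \<open>N * K\<close> times the base\<close>
    define j where "j = (LEAST j. n < N * K ^ Suc j)"
    have ex: "n < N * K ^ Suc n"
      using expo[of "Suc n"] N(2) by (metis Suc_le_eq mult.commute mult_le_mono nat_mult_1_right)
    have j1: "n < N * K ^ Suc j" unfolding j_def by (rule LeastI[of _ n]) (rule ex)
    have j2: "N * K ^ j \<le> n"
    proof (cases j)
      case 0
      have "N * K ^ 0 \<le> N * K ^ max n0 n1" using Kpos by (intro mult_le_mono) (auto simp: Suc_le_eq)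
      then show ?thesis using n 0 by (metis order_trans)
    next
      case (Suc i)
      then have "i < j" by simp
      then have "\<not> n < N * K ^ Suc i" unfolding j_def by (rule not_less_Least)
      then show ?thesis using Suc by simp
    qed
    have j: "j \<ge> max n0 n1"
    proof (rule ccontr)
      assume "\<not> ?thesis"
      then have "Suc j \<le> max n0 n1" by linarith
      then have "K ^ Suc j \<le> K ^ max n0 n1" using K(2) by (intro power_increasing) auto
      then have "N * K ^ Suc j \<le> N * K ^ max n0 n1" by (rule mult_le_mono2)
      then show False using n j1 by (meson not_le order_trans)
    qed
    let ?n = "K ^ j"
    have m: "n \<le> K * N * ?n" "r \<le> K * N * ?n" using j1 r by (auto simp: algebra_simps)
    have kn: "0 < real ?n" "0 < s ?n" using pos[OF Kpos[of j]] Kpos[of j] by auto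
    have n': "0 < n" using j2 Kpos[of j] N(2) by (metis gr0I le_zero_eq mult_is_0 not_one_le_zero)
    have le: "(real r / real ?n) powr H \<le> (real n / real ?n) powr H"
      using r H kn by (intro powr_mono2 divide_right_mono) auto
    have "real N \<le> real n / real ?n" using j2 kn
      by (metis of_nat_le_iff of_nat_mult pos_le_divide_eq)
    then have N': "real N powr H \<le> (real n / real ?n) powr H" using H by (intro powr_mono2) auto
    have pe: "0 \<le> 2 * b / \<epsilon>" using b \<open>0 < \<epsilon>\<close> by simp
    have bn: "b < (real n / real ?n) powr H" "2 * b / \<epsilon> < (real n / real ?n) powr H - b"
      using N' N(1) pe by linarith+
    have "\<bar>(s r / s ?n) / (s n / s ?n) - (real r / real ?n) powr H / (real n / real ?n) powr H\<bar>
        \<le> 2 * b / ((real n / real ?n) powr H - b)"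
      using near[OF j m(1)] near[OF j m(2)] le bn
      by (intro ratio_perturbation) (auto simp del: of_nat_power)
    also have "\<dots> \<le> 2 * b / (2 * b / \<epsilon>)"
      using bn b \<open>0 < \<epsilon>\<close> by (intro divide_left_mono mult_pos_pos) (auto intro: less_trans[of 0 "2 * b / \<epsilon>"])
    also have "\<dots> = \<epsilon>" using b by simp
    also have "(s r / s ?n) / (s n / s ?n) = s r / s n" using kn by simp
    also have "(real r / real ?n) powr H / (real n / real ?n) powr H = (real r / real n) powr H"
      using kn n' by (subst powr_divide[symmetric]) auto
    finally show "\<bar>s r / s n - (real r / real n) powr H\<bar> \<le> \<epsilon>" .
  qed
qed

section \<open>Double sums over a refining lattice\<close>

text \<open>
  The block number of the lattice point \<open>i/n\<close> in the partition of \<open>[0,1)\<close> into \<open>N\<close> equal intervals is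
  \<open>i * N div n\<close>, so the points of one block have consecutive indices and telescoping sums apply.
\<close>
lemma block_index_iff:
  fixes n N i p :: nat
  assumes "0 < n" "0 < N"
  shows "i * N div n = p \<longleftrightarrow> nat \<lceil>real p * real n / real N\<rceil> \<le> i \<and> i < nat \<lceil>real (Suc p) * real n / real N\<rceil>"
proof -
  have *: "q \<le> i * N div n \<longleftrightarrow> nat \<lceil>real q * real n / real N\<rceil> \<le> i" for q
  proof -
    have "q \<le> i * N div n \<longleftrightarrow> q * n \<le> i * N"
      using assms by (simp add: less_eq_div_iff_mult_less_eq)
    also have "\<dots> \<longleftrightarrow> real q * real n \<le> real i * real N"
      by (metis of_nat_le_iff of_nat_mult)
    also have "\<dots> \<longleftrightarrow> real q * real n / real N \<le> real i"
      using assms by (simp add: pos_divide_le_eq)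
    also have "\<dots> \<longleftrightarrow> nat \<lceil>real q * real n / real N\<rceil> \<le> i"
      by linarith
    finally show ?thesis .
  qed
  have "i * N div n = p \<longleftrightarrow> p \<le> i * N div n \<and> \<not> Suc p \<le> i * N div n" by auto
  then show ?thesis unfolding * not_le .
qed

lemma block_mass:
  fixes g :: "nat \<Rightarrow> real"
  assumes "0 < n" "0 < N" "p < N"
  shows "(\<Sum>i\<in>{i\<in>{..<n}. i * N div n = p}. g (Suc i) - g i)
    = g (nat \<lceil>real (Suc p) * real n / real N\<rceil>) - g (nat \<lceil>real p * real n / real N\<rceil>)"
proof -
  let ?e = "\<lambda>p. nat \<lceil>real p * real n / real N\<rceil>"
  have "real (Suc p) * real n / real N \<le> real N * real n / real N"
    using assms by (intro divide_right_mono mult_right_mono) auto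
  then have en: "?e (Suc p) \<le> n" using assms by (simp add: nat_le_iff ceiling_le_iff)
  have le: "?e p \<le> ?e (Suc p)"
    by (intro nat_mono ceiling_mono divide_right_mono mult_right_mono) auto
  have "{i\<in>{..<n}. i * N div n = p} = {?e p..<?e (Suc p)}"
    unfolding block_index_iff[OF assms(1,2)] atLeastLessThan_def
    using en by (blast intro: order_less_le_trans)
  then show ?thesis using sum_Suc_diff'[OF le, of g] by simp
qed


text \<open>
  Weak convergence of the weights, tested on blocks, implies convergence of the double sums: replacing
  \<open>F\<close> by its value at the lower left corners of the blocks costs no more than its oscillation over one block, and
  then only finitely many block masses are involved.
\<close>
lemma block_double_sum_limit:
  fixes w :: "nat \<Rightarrow> nat \<Rightarrow> real" and F :: "real \<Rightarrow> real \<Rightarrow> real"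
    and \<Phi> :: "nat \<Rightarrow> nat \<Rightarrow> nat \<Rightarrow> real"
  assumes nonneg: "\<forall>\<^sub>F n in sequentially. \<forall>i<n. 0 \<le> w n i"
    and mass: "\<forall>\<^sub>F n in sequentially. (\<Sum>i<n. w n i) \<le> 1"
    and unif: "\<And>\<epsilon>. 0 < \<epsilon> \<Longrightarrow> \<forall>\<^sub>F n in sequentially. \<forall>i<n. \<forall>j<n. \<bar>\<Phi> n i j - F (real i / real n) (real j / real n)\<bar> \<le> \<epsilon>"
    and cont: "uniformly_continuous_on ({0..1} \<times> {0..1}) (\<lambda>(s, t). F s t)"
    and blocks: "\<And>N p. 0 < N \<Longrightarrow> p < N \<Longrightarrow> (\<lambda>n. \<Sum>i\<in>{i\<in>{..<n}. i * N div n = p}. w n i) \<longlonglongrightarrow> m N p"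
    and lim: "(\<lambda>N. \<Sum>p<N. \<Sum>q<N. m N p * m N q * F (real p / real N) (real q / real N)) \<longlonglongrightarrow> L"
  shows "(\<lambda>n. \<Sum>i<n. \<Sum>j<n. w n i * w n j * \<Phi> n i j) \<longlonglongrightarrow> L"
proof (rule LIMSEQ_I)
  fix r :: real assume "0 < r"
  \<comment> \<open>the errors are \<open>2 * \<epsilon>\<close> from the kernel, \<open>\<epsilon>\<close> from the block masses and \<open>\<epsilon>\<close> from \<open>L\<close>\<close>
  define \<epsilon> where "\<epsilon> = r / 5"
  have \<epsilon>: "0 < \<epsilon>" using \<open>0 < r\<close> by (simp add: \<epsilon>_def)
  obtain d where d: "0 < d" and modulus: "\<And>s t s' t'. s \<in> {0..1} \<Longrightarrow> t \<in> {0..1} \<Longrightarrow> s' \<in> {0..1} \<Longrightarrow> t' \<in> {0..1} \<Longrightarrow>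
      dist (s, t) (s', t') < d \<Longrightarrow> \<bar>F s t - F s' t'\<bar> < \<epsilon>"
  proof -
    obtain d where "0 < d" and d: "\<forall>x\<in>{0..1} \<times> {0..1}. \<forall>x'\<in>{0..1} \<times> {0..1}.
        dist x' x < d \<longrightarrow> dist (case x' of (s, t) \<Rightarrow> F s t) (case x of (s, t) \<Rightarrow> F s t) < \<epsilon>"
      using cont[unfolded uniformly_continuous_on_def, rule_format, OF \<epsilon>] by (elim exE conjE)
    show thesis
    proof (rule that[OF \<open>0 < d\<close>])
      fix s t s' t' :: real
      assume "s \<in> {0..1}" "t \<in> {0..1}" "s' \<in> {0..1}" "t' \<in> {0..1}" "dist (s, t) (s', t') < d"
      then show "\<bar>F s t - F s' t'\<bar> < \<epsilon>"
        using d[rule_format, of "(s', t')" "(s, t)"] by (simp only: mem_Times_iff fst_conv snd_conv case_prod_conv dist_real_def simp_thms)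
    qed
  qed
  have "\<forall>\<^sub>F N in sequentially. 2 / real N < d"
    using d by (intro order_tendstoD(2)[OF lim_const_over_n]) 
  moreover have "\<forall>\<^sub>F N in sequentially. \<bar>(\<Sum>p<N. \<Sum>q<N. m N p * m N q * F (real p / real N) (real q / real N)) - L\<bar> < \<epsilon>"
    using lim \<epsilon> by (simp add: tendsto_iff dist_real_def)
  ultimately have "\<forall>\<^sub>F N in sequentially. 0 < N \<and> 2 / real N < d \<and>
      \<bar>(\<Sum>p<N. \<Sum>q<N. m N p * m N q * F (real p / real N) (real q / real N)) - L\<bar> < \<epsilon>"
    using eventually_gt_at_top[of 0] by eventually_elim auto
  then obtain N where N: "0 < N" "2 / real N < d"
    and GN: "\<bar>(\<Sum>p<N. \<Sum>q<N. m N p * m N q * F (real p / real N) (real q / real N)) - L\<bar> < \<epsilon>"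
    using eventually_happens'[OF sequentially_bot] by blast
  let ?G = "\<Sum>p<N. \<Sum>q<N. m N p * m N q * F (real p / real N) (real q / real N)"
  let ?W = "\<lambda>n p. \<Sum>i\<in>{i\<in>{..<n}. i * N div n = p}. w n i"
  have "(\<lambda>n. \<Sum>p<N. \<Sum>q<N. ?W n p * ?W n q * F (real p / real N) (real q / real N)) \<longlonglongrightarrow> ?G"
    using blocks N by (intro tendsto_sum tendsto_mult tendsto_const) auto
  then have ev: "\<forall>\<^sub>F n in sequentially.
      \<bar>(\<Sum>p<N. \<Sum>q<N. ?W n p * ?W n q * F (real p / real N) (real q / real N)) - ?G\<bar> < \<epsilon>"
    using \<epsilon> by (simp add: tendsto_iff dist_real_def)
  have "\<forall>\<^sub>F n in sequentially. norm ((\<Sum>i<n. \<Sum>j<n. w n i * w n j * \<Phi> n i j) - L) < r"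
    using ev nonneg mass unif[OF \<epsilon>] eventually_gt_at_top[of 0]
  proof eventually_elim
    case (elim n)
    note W = elim(1) and nn = elim(2) and ms = elim(3) and un = elim(4) and n = elim(5)
    let ?b = "\<lambda>i. i * N div n"
    have bN: "?b i < N" if "i < n" for i
      using that n N(1) by (simp add: div_less_iff_less_mult mult.commute)
    have near: "\<bar>\<Phi> n i j - F (real (?b i) / real N) (real (?b j) / real N)\<bar> \<le> 2 * \<epsilon>" if "i < n" "j < n" for i j
    proof -
      have close: "\<bar>real i / real n - real (?b i) / real N\<bar> \<le> 1 / real N" if "i < n" for i
      proof -
        have "real (i * N) = real (?b i) * real n + real ((i * N) mod n)"
          by (metis of_nat_add of_nat_mult div_mult_mod_eq)
        moreover have "real ((i * N) mod n) \<le> real n" using n by (simp add: less_imp_le)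
        ultimately have "real (?b i) * real n \<le> real i * real N" "real i * real N \<le> (real (?b i) + 1) * real n" 
          by (auto simp: algebra_simps)
        then have "real (?b i) / real N \<le> real i / real n" "real i / real n \<le> (real (?b i) + 1) / real N"
          using n N(1) by (simp_all add: divide_le_eq pos_le_divide_eq mult.commute)
        then show ?thesis by (auto simp: add_divide_distrib)
      qed
      have "dist (real i / real n, real j / real n) (real (?b i) / real N, real (?b j) / real N)
          \<le> \<bar>real i / real n - real (?b i) / real N\<bar> + \<bar>real j / real n - real (?b j) / real N\<bar>"
        unfolding dist_Pair_Pair dist_real_def by (intro sqrt_sum_squares_le_sum_abs[THEN order_trans]) auto
      also have "\<dots> \<le> 2 / real N" using close[OF that(1)] close[OF that(2)] by simp
      also have "\<dots> < d" by (rule N(2))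
      finally have "\<bar>F (real i / real n) (real j / real n) - F (real (?b i) / real N) (real (?b j) / real N)\<bar> < \<epsilon>"
        using that bN[of i] bN[of j] by (intro modulus) auto
      moreover have "\<bar>\<Phi> n i j - F (real i / real n) (real j / real n)\<bar> \<le> \<epsilon>" using un that by auto
      ultimately show ?thesis by linarith
    qed
    have group: "(\<Sum>i<n. g i) = (\<Sum>p<N. \<Sum>i\<in>{i\<in>{..<n}. ?b i = p}. g i)" for g :: "nat \<Rightarrow> real"
      using bN by (intro sum.group[symmetric]) auto
    have "(\<Sum>i<n. \<Sum>j<n. w n i * w n j * F (real (?b i) / real N) (real (?b j) / real N))
        = (\<Sum>p<N. \<Sum>q<N. ?W n p * ?W n q * F (real p / real N) (real q / real N))"
    proof -
      have "(\<Sum>i<n. \<Sum>j<n. w n i * w n j * F (real (?b i) / real N) (real (?b j) / real N))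
        = (\<Sum>p<N. \<Sum>i\<in>{i\<in>{..<n}. ?b i = p}. \<Sum>q<N. \<Sum>j\<in>{j\<in>{..<n}. ?b j = q}.
             w n i * w n j * F (real p / real N) (real q / real N))"
        unfolding group by (intro sum.cong refl) auto
      also have "\<dots> = (\<Sum>p<N. \<Sum>q<N. \<Sum>i\<in>{i\<in>{..<n}. ?b i = p}. \<Sum>j\<in>{j\<in>{..<n}. ?b j = q}.
             w n i * w n j * F (real p / real N) (real q / real N))"
        by (intro sum.cong refl sum.swap)
      also have "\<dots> = (\<Sum>p<N. \<Sum>q<N. ?W n p * ?W n q * F (real p / real N) (real q / real N))"
        by (simp only: sum_product) (simp only: sum_distrib_right)
      finally show ?thesis .
    qed
    moreover have "\<bar>(\<Sum>i<n. \<Sum>j<n. w n i * w n j * \<Phi> n i j)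
        - (\<Sum>i<n. \<Sum>j<n. w n i * w n j * F (real (?b i) / real N) (real (?b j) / real N))\<bar> \<le> 2 * \<epsilon>"
    proof -
      have "\<bar>(\<Sum>i<n. \<Sum>j<n. w n i * w n j * \<Phi> n i j)
        - (\<Sum>i<n. \<Sum>j<n. w n i * w n j * F (real (?b i) / real N) (real (?b j) / real N))\<bar>
        = \<bar>\<Sum>i<n. \<Sum>j<n. w n i * w n j * (\<Phi> n i j - F (real (?b i) / real N) (real (?b j) / real N))\<bar>"
        by (simp add: sum_subtractf right_diff_distrib)
      also have "\<dots> \<le> (\<Sum>i<n. \<Sum>j<n. w n i * w n j * (2 * \<epsilon>))"
      proof (intro order_trans[OF sum_abs] sum_mono)
        fix i j assume "i \<in> {..<n}" "j \<in> {..<n}"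
        then show "\<bar>w n i * w n j * (\<Phi> n i j - F (real (?b i) / real N) (real (?b j) / real N))\<bar> \<le> w n i * w n j * (2 * \<epsilon>)"
          unfolding abs_mult using nn near by (intro mult_mono) auto
      qed
      also have "\<dots> = (\<Sum>i<n. w n i) * (\<Sum>i<n. w n i) * (2 * \<epsilon>)"
        by (simp only: sum_product) (simp only: sum_distrib_right)
      also have "\<dots> \<le> 1 * 1 * (2 * \<epsilon>)"
        using ms nn \<epsilon> by (intro mult_mono) (auto intro!: sum_nonneg)
      finally show ?thesis by simp
    qed
    ultimately show ?case using W GN \<epsilon> unfolding \<epsilon>_def real_norm_def by linarith
  qed
  then show "\<exists>no. \<forall>n\<ge>no. norm ((\<Sum>i<n. \<Sum>j<n. w n i * w n j * \<Phi> n i j) - L) < r"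
    by (simp add: eventually_sequentially)
qed

section \<open>Second moments of stationary sequences and linear processes\<close>

definition square_integrable :: "'a measure \<Rightarrow> ('a \<Rightarrow> real) \<Rightarrow> bool" where
  "square_integrable P f \<longleftrightarrow> f \<in> borel_measurable P \<and> integrable P (\<lambda>\<omega>. (f \<omega>)\<^sup>2)"

lemma integrable_mult_square_integrable:
  assumes "square_integrable P f" "square_integrable P g"
  shows "integrable P (\<lambda>\<omega>. f \<omega> * g \<omega>)"
proof (rule Bochner_Integration.integrable_bound)
  show "integrable P (\<lambda>\<omega>. (f \<omega>)\<^sup>2 + (g \<omega>)\<^sup>2)"
    using assms by (auto simp: square_integrable_def)
  show "(\<lambda>\<omega>. f \<omega> * g \<omega>) \<in> borel_measurable P"
    using assms by (auto simp: square_integrable_def)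
  have "\<bar>x * y\<bar> \<le> x\<^sup>2 + y\<^sup>2" for x y :: real
    using sum_squares_bound[of "\<bar>x\<bar>" "\<bar>y\<bar>"] mult_nonneg_nonneg[OF abs_ge_zero[of x] abs_ge_zero[of y]]
    unfolding abs_mult power2_abs by linarith
  then show "AE \<omega> in P. norm (f \<omega> * g \<omega>) \<le> norm ((f \<omega>)\<^sup>2 + (g \<omega>)\<^sup>2)" by auto
qed

lemma square_integrable_add:
  assumes "square_integrable P f" "square_integrable P g"
  shows "square_integrable P (\<lambda>\<omega>. f \<omega> + g \<omega>)"
  using assms integrable_mult_square_integrable[OF assms]
  by (auto simp: square_integrable_def power2_sum mult.assoc)

lemma square_integrable_cmult:
  assumes "square_integrable P f"
  shows "square_integrable P (\<lambda>\<omega>. c * f \<omega>)"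
  using assms by (auto simp: square_integrable_def power_mult_distrib)

lemma square_integrable_diff:
  assumes "square_integrable P f" "square_integrable P g"
  shows "square_integrable P (\<lambda>\<omega>. f \<omega> - g \<omega>)"
  using square_integrable_add[OF assms(1) square_integrable_cmult[OF assms(2), of "-1"]] by simp

lemma square_integrable_sum:
  assumes "\<And>i. i \<in> A \<Longrightarrow> square_integrable P (f i)"
  shows "square_integrable P (\<lambda>\<omega>. \<Sum>i\<in>A. f i \<omega>)"
  using assms
proof (induction A rule: infinite_finite_induct)
  case (insert x F)
  then show ?case using square_integrable_add[of P "f x" "\<lambda>\<omega>. \<Sum>i\<in>F. f i \<omega>"] by simp
qed (simp_all add: square_integrable_def)

lemma integral_sum_mult_sum:
  assumes "\<And>i. i \<in> A \<Longrightarrow> square_integrable P (f i)" "\<And>j. j \<in> B \<Longrightarrow> square_integrable P (g j)"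
  shows "(\<integral>\<omega>. (\<Sum>i\<in>A. f i \<omega>) * (\<Sum>j\<in>B. g j \<omega>) \<partial>P) = (\<Sum>i\<in>A. \<Sum>j\<in>B. \<integral>\<omega>. f i \<omega> * g j \<omega> \<partial>P)"
  unfolding sum_product
  using assms by (subst Bochner_Integration.integral_sum;
     auto intro!: Bochner_Integration.integrable_sum integrable_mult_square_integrable sum.cong Bochner_Integration.integral_sum)

lemma Cauchy_Schwarz_square_integrable:
  assumes f: "square_integrable P f" and g: "square_integrable P g"
  shows "\<bar>\<integral>\<omega>. f \<omega> * g \<omega> \<partial>P\<bar> \<le> sqrt (\<integral>\<omega>. (f \<omega>)\<^sup>2 \<partial>P) * sqrt (\<integral>\<omega>. (g \<omega>)\<^sup>2 \<partial>P)"
proof -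
  let ?A = "\<integral>\<omega>. (f \<omega>)\<^sup>2 \<partial>P" and ?B = "\<integral>\<omega>. (g \<omega>)\<^sup>2 \<partial>P" and ?C = "\<integral>\<omega>. f \<omega> * g \<omega> \<partial>P"
  have quad: "0 \<le> ?A + 2 * t * ?C + t\<^sup>2 * ?B" for t
  proof -
    have "0 \<le> (\<integral>\<omega>. (f \<omega> + t * g \<omega>)\<^sup>2 \<partial>P)" by simp
    also have "\<dots> = (\<integral>\<omega>. (f \<omega>)\<^sup>2 + (2 * t) * (f \<omega> * g \<omega>) + t\<^sup>2 * (g \<omega>)\<^sup>2 \<partial>P)"
      by (simp add: power2_sum power_mult_distrib algebra_simps)
    also have "\<dots> = ?A + 2 * t * ?C + t\<^sup>2 * ?B"
      using f g integrable_mult_square_integrable[OF f g]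
      by (simp add: square_integrable_def)
    finally show ?thesis .
  qed
  have "?C\<^sup>2 \<le> ?A * ?B"
  proof (cases "?B = 0")
    case True
    have "?C = 0"
    proof (rule ccontr)
      assume "?C \<noteq> 0"
      then show False using quad[of "- (?A + 1) / (2 * ?C)"] True by (simp add: field_simps)
    qed
    then show ?thesis using True by simp
  next
    case False
    then have "0 < ?B" by (simp add: less_le)
    then show ?thesis using quad[of "- ?C / ?B"] by (simp add: field_simps power2_eq_square)
  qed
  from real_sqrt_le_mono[OF this] show ?thesis by (simp only: real_sqrt_abs real_sqrt_mult)
qed

text \<open>
  The inner product of \<open>L\<^sup>2\<close> is jointly continuous; it is applied along the net of finite partial sums.
\<close>
lemma tendsto_integral_mult_mean_square:
  assumes sq: "square_integrable P f" "square_integrable P g"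
    "\<And>x. square_integrable P (u x)" "\<And>x. square_integrable P (v x)"
    and lim: "((\<lambda>x. \<integral>\<omega>. (f \<omega> - u x \<omega>)\<^sup>2 \<partial>P) \<longlongrightarrow> 0) F" "((\<lambda>x. \<integral>\<omega>. (g \<omega> - v x \<omega>)\<^sup>2 \<partial>P) \<longlongrightarrow> 0) F"
  shows "((\<lambda>x. \<integral>\<omega>. u x \<omega> * v x \<omega> \<partial>P) \<longlongrightarrow> (\<integral>\<omega>. f \<omega> * g \<omega> \<partial>P)) F"
proof -
  let ?n = "\<lambda>f. sqrt (\<integral>\<omega>. (f \<omega>)\<^sup>2 \<partial>P)"
  have fu: "square_integrable P (\<lambda>\<omega>. f \<omega> - u x \<omega>)" and gv: "square_integrable P (\<lambda>\<omega>. g \<omega> - v x \<omega>)" for x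
    using sq by (auto intro: square_integrable_diff)
  have lim': "((\<lambda>x. ?n (\<lambda>\<omega>. f \<omega> - u x \<omega>)) \<longlongrightarrow> 0) F" "((\<lambda>x. ?n (\<lambda>\<omega>. g \<omega> - v x \<omega>)) \<longlongrightarrow> 0) F"
    using lim[THEN tendsto_real_sqrt] by simp_all
  have bound: "norm ((\<integral>\<omega>. u x \<omega> * v x \<omega> \<partial>P) - (\<integral>\<omega>. f \<omega> * g \<omega> \<partial>P))
     \<le> ?n f * ?n (\<lambda>\<omega>. g \<omega> - v x \<omega>) + ?n (\<lambda>\<omega>. f \<omega> - u x \<omega>) * ?n g
       + ?n (\<lambda>\<omega>. f \<omega> - u x \<omega>) * ?n (\<lambda>\<omega>. g \<omega> - v x \<omega>)" for x
  proof -
    have "(\<integral>\<omega>. u x \<omega> * v x \<omega> \<partial>P) = (\<integral>\<omega>. f \<omega> * g \<omega> - f \<omega> * (g \<omega> - v x \<omega>) - (f \<omega> - u x \<omega>) * g \<omega>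
        + (f \<omega> - u x \<omega>) * (g \<omega> - v x \<omega>) \<partial>P)"
      by (intro Bochner_Integration.integral_cong) (auto simp: algebra_simps)
    also have "\<dots> = (\<integral>\<omega>. f \<omega> * g \<omega> \<partial>P) - (\<integral>\<omega>. f \<omega> * (g \<omega> - v x \<omega>) \<partial>P) - (\<integral>\<omega>. (f \<omega> - u x \<omega>) * g \<omega> \<partial>P)
        + (\<integral>\<omega>. (f \<omega> - u x \<omega>) * (g \<omega> - v x \<omega>) \<partial>P)"
      using integrable_mult_square_integrable[OF sq(1,2)] integrable_mult_square_integrable[OF sq(1) gv[of x]]
        integrable_mult_square_integrable[OF fu[of x] sq(2)] integrable_mult_square_integrable[OF fu[of x] gv[of x]]
      by simp
    finally show ?thesis
      using Cauchy_Schwarz_square_integrable[OF sq(1) gv[of x]] Cauchy_Schwarz_square_integrable[OF fu[of x] sq(2)]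
        Cauchy_Schwarz_square_integrable[OF fu[of x] gv[of x]]
      unfolding real_norm_def by linarith
  qed
  have "((\<lambda>x. ?n f * ?n (\<lambda>\<omega>. g \<omega> - v x \<omega>) + ?n (\<lambda>\<omega>. f \<omega> - u x \<omega>) * ?n g
       + ?n (\<lambda>\<omega>. f \<omega> - u x \<omega>) * ?n (\<lambda>\<omega>. g \<omega> - v x \<omega>)) \<longlongrightarrow> ?n f * 0 + 0 * ?n g + 0 * 0) F"
    using lim' by (intro tendsto_intros)
  then have "((\<lambda>x. ?n f * ?n (\<lambda>\<omega>. g \<omega> - v x \<omega>) + ?n (\<lambda>\<omega>. f \<omega> - u x \<omega>) * ?n g
       + ?n (\<lambda>\<omega>. f \<omega> - u x \<omega>) * ?n (\<lambda>\<omega>. g \<omega> - v x \<omega>)) \<longlongrightarrow> 0) F"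
    by (simp only: mult_zero_right mult_zero_left add_0_right)
  then have "((\<lambda>x. (\<integral>\<omega>. u x \<omega> * v x \<omega> \<partial>P) - (\<integral>\<omega>. f \<omega> * g \<omega> \<partial>P)) \<longlongrightarrow> 0) F"
    by (rule Lim_null_comparison[OF always_eventually, rotated]) (intro allI bound)
  then show ?thesis by (simp add: LIM_zero_iff)
qed

text \<open>
  Wide-sense stationarity: only the mean and the covariances matter for the variances considered here.
\<close>
locale centered_stationary = prob_space P for P :: "'a measure" +
  fixes X :: "int \<Rightarrow> 'a \<Rightarrow> real"
  assumes sq: "square_integrable P (X j)"
    and mean: "expectation (X j) = 0"
    and shift: "expectation (\<lambda>\<omega>. X (i + c) \<omega> * X (j + c) \<omega>) = expectation (\<lambda>\<omega>. X i \<omega> * X j \<omega>)"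
begin

lemma integrable_square_integrable: "square_integrable P f \<Longrightarrow> integrable P f"
  by (auto simp: square_integrable_def intro: square_integrable_imp_integrable)

lemma sq_S: "square_integrable P (S_sum X n)"
  using square_integrable_sum[of "{1..n}" P "\<lambda>i. X (int i)"] sq unfolding S_sum_def[abs_def] by simp

lemma mean_S: "expectation (S_sum X n) = 0"
  unfolding S_sum_def[abs_def] using sq integrable_square_integrable mean
  by (subst Bochner_Integration.integral_sum) auto

lemma S_increment:
  "expectation (\<lambda>\<omega>. (S_sum X (m + k) \<omega> - S_sum X m \<omega>)\<^sup>2) = expectation (\<lambda>\<omega>. (S_sum X k \<omega>)\<^sup>2)"
proof -
  have "S_sum X (m + k) \<omega> - S_sum X m \<omega> = (\<Sum>i=1..k. X (int i + int m) \<omega>)" for \<omega>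
    unfolding S_sum_def
    by (induction k) (auto simp: ac_simps)
  then show ?thesis
    using sq shift[of _ "int m"]
    by (simp add: S_sum_def power2_eq_square integral_sum_mult_sum)
qed

text \<open>
  Polarisation: by stationarity the increment between the two partial sums has the variance of
  \<open>S\<^bsub>\<bar>m-n\<bar>\<^esub>\<close>.
\<close>
lemma S_covariance:
  "expectation (\<lambda>\<omega>. S_sum X m \<omega> * S_sum X n \<omega>) =
   (expectation (\<lambda>\<omega>. (S_sum X m \<omega>)\<^sup>2) + expectation (\<lambda>\<omega>. (S_sum X n \<omega>)\<^sup>2)
     - expectation (\<lambda>\<omega>. (S_sum X (nat \<bar>int m - int n\<bar>) \<omega>)\<^sup>2)) / 2"
proof -
  have *: "expectation (\<lambda>\<omega>. S_sum X m \<omega> * S_sum X (m + k) \<omega>) =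
   (expectation (\<lambda>\<omega>. (S_sum X m \<omega>)\<^sup>2) + expectation (\<lambda>\<omega>. (S_sum X (m + k) \<omega>)\<^sup>2)
     - expectation (\<lambda>\<omega>. (S_sum X k \<omega>)\<^sup>2)) / 2" for m k
  proof -
    have "expectation (\<lambda>\<omega>. (S_sum X k \<omega>)\<^sup>2)
        = expectation (\<lambda>\<omega>. (S_sum X (m + k) \<omega>)\<^sup>2 + (S_sum X m \<omega>)\<^sup>2 - 2 * (S_sum X m \<omega> * S_sum X (m + k) \<omega>))"
      unfolding S_increment[of m k, symmetric] by (simp add: power2_diff algebra_simps)
    also have "\<dots> = expectation (\<lambda>\<omega>. (S_sum X (m + k) \<omega>)\<^sup>2) + expectation (\<lambda>\<omega>. (S_sum X m \<omega>)\<^sup>2)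
        - 2 * expectation (\<lambda>\<omega>. S_sum X m \<omega> * S_sum X (m + k) \<omega>)"
      using sq_S integrable_mult_square_integrable[OF sq_S sq_S] by (simp add: square_integrable_def)
    finally show ?thesis by simp
  qed
  show ?thesis
  proof (cases "m \<le> n")
    case True
    then have "nat \<bar>int m - int n\<bar> = n - m" "m + (n - m) = n" by auto
    then show ?thesis using *[of m "n - m"] by simp
  next
    case False
    then have "nat \<bar>int m - int n\<bar> = m - n" "n + (m - n) = m" by auto
    then show ?thesis using *[of n "m - n"] by (simp add: mult.commute)
  qed
qed

text \<open>
  The triangle inequality in \<open>L\<^sup>2\<close>, since the increment \<open>S\<^bsub>m+k\<^esub> - S\<^sub>m\<close> has the norm of \<open>S\<^sub>k\<close>.
\<close>
lemma S_deviation_increment: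
  defines "s \<equiv> \<lambda>n. sqrt (expectation (\<lambda>\<omega>. (S_sum X n \<omega>)\<^sup>2))"
  shows "\<bar>s (m + k) - s m\<bar> \<le> s k"
proof -
  have s2: "(s n)\<^sup>2 = expectation (\<lambda>\<omega>. (S_sum X n \<omega>)\<^sup>2)" and s0: "0 \<le> s n" for n by (simp_all add: s_def)
  \<comment> \<open>the covariance of the two sums determines the variance of the increment\<close>
  have "expectation (\<lambda>\<omega>. S_sum X m \<omega> * S_sum X (m + k) \<omega>) \<le> s m * s (m + k)"
    using Cauchy_Schwarz_square_integrable[OF sq_S[of m] sq_S[of "m + k"]] unfolding s_def by linarith
  then have "(s (m + k) - s m)\<^sup>2 \<le> (s k)\<^sup>2"
    unfolding S_covariance s2[symmetric] by (simp add: power2_diff field_simps)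
  then show ?thesis using s0 by (metis abs_le_square_iff abs_of_nonneg)
qed

text \<open>
  Interchanging the two summations collects, for each \<open>i\<close>, the variables \<open>X\<^sub>1, \<dots>, X\<^bsub>n-i\<^esub>\<close>
  with the same coefficient.
\<close>
lemma R_sum_eq: "R_sum X M n \<omega> = (\<Sum>i<n. Delta M i * S_sum X (n - i) \<omega>)"
proof (induction n)
  case (Suc n)
  have v: "v_term X M (Suc n) \<omega> = (\<Sum>i<Suc n. Delta M i * X (int (Suc n - i)) \<omega>)"
    unfolding v_term_def by (intro sum.cong) (auto simp: of_nat_diff mult.commute)
  have "(\<Sum>i<Suc n. Delta M i * S_sum X (Suc n - i) \<omega>)
      = (\<Sum>i<Suc n. Delta M i * S_sum X (n - i) \<omega> + Delta M i * X (int (Suc n - i)) \<omega>)"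
    by (intro sum.cong) (auto simp: S_sum_def Suc_diff_le algebra_simps)
  also have "\<dots> = R_sum X M n \<omega> + v_term X M (Suc n) \<omega>"
    unfolding v Suc.IH sum.distrib by (simp add: S_sum_def)
  finally show ?case by (simp add: R_sum_def)
qed (simp add: R_sum_def v_term_def)

lemma variance_S: "variance (S_sum X n) = expectation (\<lambda>\<omega>. (S_sum X n \<omega>)\<^sup>2)"
  using mean_S by (rule variance_mean_zero)

lemma variance_R:
  "variance (R_sum X M n) = (\<Sum>i<n. \<Sum>j<n. Delta M i * Delta M j *
     ((variance (S_sum X (n - i)) + variance (S_sum X (n - j)) - variance (S_sum X (nat \<bar>int i - int j\<bar>))) / 2))"
proof -
  have R: "R_sum X M n = (\<lambda>\<omega>. \<Sum>i<n. Delta M i * S_sum X (n - i) \<omega>)" by (rule ext) (rule R_sum_eq)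
  have "expectation (R_sum X M n) = 0"
    unfolding R using integrable_square_integrable[OF sq_S] mean_S
    by (subst Bochner_Integration.integral_sum) auto
  then have "variance (R_sum X M n) = expectation (\<lambda>\<omega>. (R_sum X M n \<omega>)\<^sup>2)" by (rule variance_mean_zero)
  also have "\<dots> = (\<Sum>i<n. \<Sum>j<n. expectation (\<lambda>\<omega>. (Delta M i * S_sum X (n - i) \<omega>) * (Delta M j * S_sum X (n - j) \<omega>)))"
    unfolding R power2_eq_square by (intro integral_sum_mult_sum square_integrable_cmult sq_S)
  also have "\<dots> = (\<Sum>i<n. \<Sum>j<n. Delta M i * Delta M j * expectation (\<lambda>\<omega>. S_sum X (n - i) \<omega> * S_sum X (n - j) \<omega>))"
    by (simp add: mult_ac flip: integral_mult_right_zero)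
  also have "\<dots> = (\<Sum>i<n. \<Sum>j<n. Delta M i * Delta M j *
     ((variance (S_sum X (n - i)) + variance (S_sum X (n - j)) - variance (S_sum X (nat \<bar>int i - int j\<bar>))) / 2))"
  proof (intro sum.cong refl)
    fix i j assume "i \<in> {..<n}" "j \<in> {..<n}"
    then have "nat \<bar>int (n - i) - int (n - j)\<bar> = nat \<bar>int i - int j\<bar>" by auto
    then show "Delta M i * Delta M j * expectation (\<lambda>\<omega>. S_sum X (n - i) \<omega> * S_sum X (n - j) \<omega>) =
      Delta M i * Delta M j *
     ((variance (S_sum X (n - i)) + variance (S_sum X (n - j)) - variance (S_sum X (nat \<bar>int i - int j\<bar>))) / 2)"
      unfolding S_covariance variance_S by simp
  qed
  finally show ?thesis .
qed

end

text \<open>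
  By orthonormality of the innovations the covariance of \<open>X\<^sub>i\<close> and \<open>X\<^sub>j\<close> is
  \<open>\<Sum>k. a\<^bsub>i-k\<^esub> a\<^bsub>j-k\<^esub>\<close>, and the substitution \<open>k \<mapsto> k + c\<close> shows that it is shift invariant.
\<close>
lemma linear_process_centered_stationary:
  fixes \<xi> :: "int \<Rightarrow> 'a \<Rightarrow> real"
  assumes P: "prob_space P"
    and indep: "prob_space.indep_vars P (\<lambda>_. borel) \<xi> UNIV"
    and int: "\<And>k. integrable P (\<xi> k)"
    and mean: "\<And>k. prob_space.expectation P (\<xi> k) = 0"
    and var: "\<And>k. prob_space.variance P (\<xi> k) = 1"
    and X: "\<And>j. has_L2_sum P (\<lambda>k \<omega>. a (j - k) * \<xi> k \<omega>) (X j) UNIV"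
  shows "centered_stationary P X"
proof -
  interpret prob_space P by (rule P)
  have var': "expectation (\<lambda>\<omega>. (\<xi> k \<omega>)\<^sup>2) = 1" for k using var[of k] mean[of k] by simp
  \<comment> \<open>the integral of a non-integrable function would be 0\<close>
  have "integrable P (\<lambda>\<omega>. (\<xi> k \<omega>)\<^sup>2)" for k
    using var'[of k] not_integrable_integral_eq[of P "\<lambda>\<omega>. (\<xi> k \<omega>)\<^sup>2"] by auto
  then have sq_xi: "square_integrable P (\<xi> k)" for k
    using int[of k] by (auto simp: square_integrable_def)
  have orth: "expectation (\<lambda>\<omega>. \<xi> j \<omega> * \<xi> k \<omega>) = (if j = k then 1 else 0)" for j k
  proof (cases "j = k")
    case False
    then have "expectation (\<lambda>\<omega>. \<Prod>i\<in>{j, k}. \<xi> i \<omega>) = (\<Prod>i\<in>{j, k}. expectation (\<xi> i))"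
      using indep_vars_subset[OF indep, of "{j, k}"] int
      by (intro indep_vars_lebesgue_integral) auto
    then show ?thesis using False mean by simp
  qed (use var' in \<open>simp add: power2_eq_square\<close>)
  let ?u = "\<lambda>j F \<omega>. \<Sum>k\<in>F. a (j - k) * \<xi> k \<omega>"
  have sq_u: "square_integrable P (?u j F)" for j F
    by (intro square_integrable_sum square_integrable_cmult sq_xi)
  have sq_X: "square_integrable P (X j)" for j
    using X[of j] by (simp add: has_L2_sum_def square_integrable_def)
  have lim: "((\<lambda>F. \<integral>\<omega>. (X j \<omega> - ?u j F \<omega>)\<^sup>2 \<partial>P) \<longlongrightarrow> 0) (finite_subsets_at_top UNIV)" for j
    using X[of j] by (simp add: has_L2_sum_def)
  have cov: "((\<lambda>k. a (i - k) * a (j - k)) has_sum expectation (\<lambda>\<omega>. X i \<omega> * X j \<omega>)) UNIV" for i j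
  proof -
    have "expectation (\<lambda>\<omega>. ?u i F \<omega> * ?u j F \<omega>) = (\<Sum>k\<in>F. a (i - k) * a (j - k))" if "finite F" for F
    proof -
      have "expectation (\<lambda>\<omega>. ?u i F \<omega> * ?u j F \<omega>)
          = (\<Sum>k\<in>F. \<Sum>l\<in>F. expectation (\<lambda>\<omega>. (a (i - k) * \<xi> k \<omega>) * (a (j - l) * \<xi> l \<omega>)))"
        by (intro integral_sum_mult_sum square_integrable_cmult sq_xi)
      also have "\<dots> = (\<Sum>k\<in>F. \<Sum>l\<in>F. (a (i - k) * a (j - l)) * expectation (\<lambda>\<omega>. \<xi> k \<omega> * \<xi> l \<omega>))"
        by (simp add: mult_ac flip: integral_mult_right_zero)
      also have "\<dots> = (\<Sum>k\<in>F. a (i - k) * a (j - k))"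
        using that by (simp add: orth if_distrib sum.delta cong: if_cong)
      finally show ?thesis .
    qed
    then have ev: "\<forall>\<^sub>F F in finite_subsets_at_top UNIV.
        expectation (\<lambda>\<omega>. ?u i F \<omega> * ?u j F \<omega>) = (\<Sum>k\<in>F. a (i - k) * a (j - k))"
      by (intro eventually_finite_subsets_at_top_weakI)
    show ?thesis unfolding has_sum_def
      using tendsto_integral_mult_mean_square[OF sq_X sq_X sq_u sq_u lim lim, of i j]
      by (rule tendsto_cong[OF ev, THEN iffD1])
  qed
  show ?thesis
  proof unfold_locales
    show "square_integrable P (X j)" for j by (rule sq_X)
    show "expectation (X j) = 0" for j
    proof -
      have one: "square_integrable P (\<lambda>_. 1)" by (simp add: square_integrable_def)
      have "((\<lambda>F. expectation (\<lambda>\<omega>. ?u j F \<omega> * 1)) \<longlongrightarrow> expectation (\<lambda>\<omega>. X j \<omega> * 1)) (finite_subsets_at_top UNIV)"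
        by (rule tendsto_integral_mult_mean_square[OF sq_X one sq_u one lim]) simp
      moreover have "expectation (\<lambda>\<omega>. ?u j F \<omega> * 1) = 0" for F
        using int mean by (simp add: Bochner_Integration.integral_sum)
      ultimately show ?thesis using tendsto_unique[OF finite_subsets_at_top_neq_bot] tendsto_const by (simp add: tendsto_const_iff)
    qed
    show "expectation (\<lambda>\<omega>. X (i + c) \<omega> * X (j + c) \<omega>) = expectation (\<lambda>\<omega>. X i \<omega> * X j \<omega>)" for i j c
    proof -
      have "bij_betw (\<lambda>k::int. k + c) UNIV UNIV" by (rule bij_betwI[of _ _ _ "\<lambda>k. k - c"]) auto
      then have "((\<lambda>k. a (i - k) * a (j - k)) has_sum expectation (\<lambda>\<omega>. X (i + c) \<omega> * X (j + c) \<omega>)) UNIV"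
        using cov[of "i + c" "j + c"]
          has_sum_reindex_bij_betw[of "\<lambda>k. k + c" UNIV UNIV "\<lambda>k. a (i + c - k) * a (j + c - k)"] by simp
      then show ?thesis using cov has_sum_unique by blast
    qed
  qed
qed

section \<open>Increments of the memory function\<close>

lemma mono_R_class:
  assumes "0 \<le> \<nu>" "M \<in> R_class \<nu>" "0 \<le> s" "s \<le> t"
  shows "M s \<le> M t"
proof -
  obtain l where l: "\<And>t. 0 \<le> t \<Longrightarrow> 0 \<le> l t" "mono_on {0..} l" "\<And>t. 0 \<le> t \<Longrightarrow> M t = l t * pow0 t \<nu>"
    using assms(2) unfolding R_class_def by blast
  have "l s \<le> l t" using l(2) assms(3,4) by (auto simp: mono_on_def)
  moreover have "pow0 s \<nu> \<le> pow0 t \<nu>" "0 \<le> pow0 s \<nu>"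
    using assms by (auto simp: pow0_def intro: powr_mono2)
  ultimately show ?thesis using l(1,3) assms(3,4) by (simp add: mult_mono)
qed

lemma nonneg_R_class:
  assumes "M \<in> R_class \<nu>" "0 \<le> t"
  shows "0 \<le> M t"
  using assms unfolding R_class_def by (force simp: pow0_def)

lemma R_class_exceeds_0:
  assumes "0 \<le> \<nu>" "M \<in> R_class \<nu>"
  obtains t where "0 \<le> t" "M 0 < M t"
proof -
  have "\<not> M constant_on {0..}" using assms(2) by (simp add: R_class_def)
  then obtain t where "0 \<le> t" "M t \<noteq> M 0" unfolding constant_on_def by auto
  then show ?thesis using mono_R_class[OF assms, of 0 t] by (intro that[of t]) auto
qed

lemma eventually_pos_R_class:
  assumes "0 \<le> \<nu>" "M \<in> R_class \<nu>"
  shows "\<forall>\<^sub>F n in sequentially. 0 < M (real n)"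
proof -
  obtain t where t: "0 \<le> t" "M 0 < M t" using R_class_exceeds_0[OF assms] .
  have "\<forall>\<^sub>F n in sequentially. t \<le> real n"
    using filterlim_real_sequentially by (auto simp: filterlim_at_top)
  then show ?thesis
  proof eventually_elim
    case (elim n)
    show ?case using mono_R_class[OF assms t(1) elim] t nonneg_R_class[OF assms(2), of 0] by simp
  qed
qed

text \<open>
  The quotient \<open>l(x) / l(x)\<close> tends to \<open>1\<close>, while division by zero yields \<open>0\<close>.
\<close>
lemma eventually_pos_slowly_varying:
  assumes "slowly_varying l" "\<And>t. 0 \<le> t \<Longrightarrow> 0 \<le> l t"
  shows "\<forall>\<^sub>F x in at_top. 0 < l x"
proof -
  have "((\<lambda>x. l (1 * x) / l x) \<longlongrightarrow> 1) at_top"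
    using assms(1) unfolding slowly_varying_def by (metis zero_less_one)
  then have "\<forall>\<^sub>F x in at_top. 0 < l (1 * x) / l x" by (rule order_tendstoD) simp
  with eventually_ge_at_top[of 0] show ?thesis
  proof eventually_elim
    case (elim x)
    then show ?case using assms(2)[of x] by (cases "l x = 0") auto
  qed
qed

text \<open>
  The factor \<open>l\<close> contributes \<open>1\<close> in the limit: by monotonicity its value at the rounded point lies
  between the values at \<open>(p/N) n\<close> and at \<open>n\<close>, whose quotient tends to \<open>1\<close>. At \<open>p = 0\<close> this argument
  breaks down, and so does the conclusion for \<open>\<nu> = 0\<close>.
\<close>
lemma R_class_lattice_quotient:
  fixes p N :: nat
  assumes \<nu>: "0 \<le> \<nu>" and M: "M \<in> R_class \<nu>" and p: "0 < p" "p \<le> N"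
  shows "(\<lambda>n. M (real (nat \<lceil>real p * real n / real N\<rceil>)) / M (real n)) \<longlonglongrightarrow> pow0 (real p / real N) \<nu>"
proof -
  obtain l where l: "\<And>t. 0 \<le> t \<Longrightarrow> 0 \<le> l t" "mono_on {0..} l" "slowly_varying l"
      "\<And>t. 0 \<le> t \<Longrightarrow> M t = l t * pow0 t \<nu>"
    using M unfolding R_class_def by blast
  define k where "k n = real (nat \<lceil>real p * real n / real N\<rceil>)" for n :: nat
  define x where "x = real p / real N"
  have x: "0 < x" "x \<le> 1" using p by (auto simp: x_def)
  have k: "x * real n \<le> k n" "k n \<le> x * real n + 1" for n
  proof -
    have "0 \<le> real p * real n / real N" by simp
    then have "real p * real n / real N \<le> k n" "k n \<le> real p * real n / real N + 1"
      unfolding k_def by linarith+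
    then show "x * real n \<le> k n" "k n \<le> x * real n + 1" by (simp_all add: x_def)
  qed
  have k0: "0 \<le> k n" for n unfolding k_def by (rule of_nat_0_le_iff)
  have kn: "k n \<le> real n" for n
  proof -
    have "real p * real n / real N \<le> real n" using x mult_right_mono[OF x(2), of "real n"] by (simp add: x_def)
    then have "\<lceil>real p * real n / real N\<rceil> \<le> int n" by (simp only: ceiling_le_iff of_int_of_nat_eq)
    then show ?thesis unfolding k_def by linarith
  qed
  have lmono: "l s \<le> l t" if "0 \<le> s" "s \<le> t" for s t
    using l(2) that by (auto simp: mono_on_def)
  have lpos: "\<forall>\<^sub>F n in sequentially. 0 < l (real n)"
    using eventually_compose_filterlim[OF eventually_pos_slowly_varying[OF l(3,1)] filterlim_real_sequentially] .
  have lower: "(\<lambda>n. l (x * real n) / l (real n)) \<longlonglongrightarrow> 1"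
    using filterlim_compose[OF _ filterlim_real_sequentially] l(3) x(1) unfolding slowly_varying_def by blast
  have L: "(\<lambda>n. l (k n) / l (real n)) \<longlonglongrightarrow> 1"
  proof (rule real_tendsto_sandwich[OF _ _ lower tendsto_const])
    show "\<forall>\<^sub>F n in sequentially. l (x * real n) / l (real n) \<le> l (k n) / l (real n)"
      using lpos by eventually_elim
        (use lmono k x in \<open>auto intro!: divide_right_mono\<close>)
    show "\<forall>\<^sub>F n in sequentially. l (k n) / l (real n) \<le> 1"
      using lpos by eventually_elim
        (use lmono kn k0 in auto)
  qed
  have "(\<lambda>n. k n / real n) \<longlonglongrightarrow> x"
  proof (rule real_tendsto_sandwich)
    show "\<forall>\<^sub>F n in sequentially. x \<le> k n / real n" "\<forall>\<^sub>F n in sequentially. k n / real n \<le> x + 1 / real n"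
      using eventually_gt_at_top[of 0] by (eventually_elim, use k in \<open>simp add: field_simps\<close>)+
    show "(\<lambda>n. x + 1 / real n) \<longlonglongrightarrow> x" using tendsto_add[OF tendsto_const lim_1_over_n, of x] by simp
  qed simp
  then have P: "(\<lambda>n. pow0 (k n / real n) \<nu>) \<longlonglongrightarrow> pow0 x \<nu>"
    using x unfolding pow0_def by (auto intro!: tendsto_powr)
  have "(\<lambda>n. l (k n) / l (real n) * pow0 (k n / real n) \<nu>) \<longlonglongrightarrow> pow0 x \<nu>"
    using tendsto_mult[OF L P] by simp
  moreover have "\<forall>\<^sub>F n in sequentially. l (k n) / l (real n) * pow0 (k n / real n) \<nu> = M (k n) / M (real n)"
    using eventually_gt_at_top[of 0]
  proof eventually_elim
    case (elim n)
    show ?case using l(4) k0[of n] by (auto simp: pow0_def powr_divide)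
  qed
  ultimately show ?thesis unfolding k_def x_def by (rule Lim_transform_eventually)
qed

text \<open>
  The masses that the weights give to a block telescope. Block \<open>0\<close> is special because its left
  endpoint stays at the argument \<open>0\<close> of \<open>M\<close>; it keeps the mass \<open>1 - r\<close> when \<open>\<nu> = 0\<close>.
\<close>
lemma R_class_block_limit:
  fixes p N :: nat
  assumes \<nu>: "0 \<le> \<nu>" and M: "M \<in> R_class \<nu>" and p: "p < N"
    and r: "(\<lambda>n. M 0 / M (real n)) \<longlonglongrightarrow> r"
  shows "(\<lambda>n. \<Sum>i\<in>{i\<in>{..<n}. i * N div n = p}. Delta M i / M (real n)) \<longlonglongrightarrow>
    pow0 (real (Suc p) / real N) \<nu> - (if p = 0 then r else pow0 (real p / real N) \<nu>)"
proof -
  let ?e = "\<lambda>p n. real (nat \<lceil>real p * real n / real N\<rceil>)"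
  have "(\<lambda>n. M (?e (Suc p) n) / M (real n) - M (?e p n) / M (real n)) \<longlonglongrightarrow>
     pow0 (real (Suc p) / real N) \<nu> - (if p = 0 then r else pow0 (real p / real N) \<nu>)"
    using R_class_lattice_quotient[OF \<nu> M, of "Suc p" N] R_class_lattice_quotient[OF \<nu> M, of p N] p r
    by (intro tendsto_diff) auto
  moreover have "\<forall>\<^sub>F n in sequentially. M (?e (Suc p) n) / M (real n) - M (?e p n) / M (real n)
      = (\<Sum>i\<in>{i\<in>{..<n}. i * N div n = p}. Delta M i / M (real n))"
    using eventually_gt_at_top[of 0]
  proof eventually_elim
    case (elim n)
    have "(\<Sum>i\<in>{i\<in>{..<n}. i * N div n = p}. Delta M i) = M (?e (Suc p) n) - M (?e p n)"
      using block_mass[OF elim _ p, of "\<lambda>i. M (real i)"] p by (simp add: Delta_def add.commute)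
    then show ?case by (simp only: diff_divide_distrib flip: sum_divide_distrib)
  qed
  ultimately show ?thesis by (rule Lim_transform_eventually)
qed

text \<open>
  A monotone function tends to its supremum in the extended reals. The supremum exceeds \<open>M(0)\<close> because
  \<open>M\<close> is not constant.
\<close>
lemma tendsto_end_ratio:
  assumes M: "M \<in> R_class 0"
  shows "(\<lambda>n. M 0 / M (real n)) \<longlonglongrightarrow> end_ratio M" and "end_ratio M < 1"
proof -
  note mono = mono_R_class[OF order_refl M] and nonneg = nonneg_R_class[OF M]
  define L where "L = (SUP t\<in>{0..}. ereal (M t))"
  have lim: "((\<lambda>t. ereal (M t)) \<longlongrightarrow> L) at_top"
  proof (rule order_tendstoI)
    fix a assume "a < L"
    then obtain t where "0 \<le> t" "a < ereal (M t)" unfolding L_def less_SUP_iff by auto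
    then have "a < ereal (M u)" if "t \<le> u" for u
      using mono[of t u] that by (meson ereal_less_eq(3) less_le_trans)
    then show "\<forall>\<^sub>F t in at_top. a < ereal (M t)" by (auto simp: eventually_at_top_linorder)
  next
    fix a assume "L < a"
    then have "ereal (M t) < a" if "0 \<le> t" for t
      using that unfolding L_def by (meson SUP_upper atLeast_iff le_less_trans)
    then show "\<forall>\<^sub>F t in at_top. ereal (M t) < a" by (auto simp: eventually_at_top_linorder)
  qed
  then have at: "at_infty M = L" unfolding at_infty_def by (intro tendsto_Lim) auto
  have limn: "(\<lambda>n. ereal (M (real n))) \<longlonglongrightarrow> L" using filterlim_compose[OF lim filterlim_real_sequentially] .
  obtain t where t: "0 \<le> t" "M 0 < M t" using R_class_exceeds_0[OF order_refl M] .
  have tL: "ereal (M t) \<le> L" unfolding L_def using t by (intro SUP_upper) auto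
  have "((\<lambda>n. M 0 / M (real n)) \<longlonglongrightarrow> end_ratio M) \<and> end_ratio M < 1"
  proof (cases L)
    case (real y)
    then have y: "M 0 < y" "0 < y" using t tL nonneg[of 0] by auto
    then have "end_ratio M = M 0 / y" by (simp add: end_ratio_def at real)
    moreover have "(\<lambda>n. M 0 / M (real n)) \<longlonglongrightarrow> M 0 / y"
      using limn y by (intro tendsto_divide) (auto simp: real)
    ultimately show ?thesis using y by simp
  next
    case PInf
    have "filterlim (\<lambda>n. M (real n)) at_top sequentially"
      using limn by (simp add: PInf tendsto_PInfty_eq_at_top)
    then have "(\<lambda>n. M 0 / M (real n)) \<longlonglongrightarrow> 0"
      by (intro real_tendsto_divide_at_top[OF tendsto_const])
    then show ?thesis by (simp add: end_ratio_def at PInf)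
  next
    case MInf
    then show ?thesis using tL by simp
  qed
  then show "(\<lambda>n. M 0 / M (real n)) \<longlonglongrightarrow> end_ratio M" "end_ratio M < 1" by auto
qed

section \<open>The power law on the unit interval and the covariance kernel\<close>

text \<open>
  The law with distribution function \<open>s\<^bsup>\<nu>\<^esup>\<close> on \<open>[0,1]\<close>. The endpoints are left out, so
  that almost every point lies in the open interval, where the kernel below is strictly positive.
\<close>
definition power_law :: "real \<Rightarrow> real measure" where
  "power_law \<nu> = density lborel (\<lambda>s. ennreal (indicator {0<..<1} s * (\<nu> * s powr (\<nu> - 1))))"

lemma sets_power_law [simp, measurable_cong]: "sets (power_law \<nu>) = sets borel"
  and space_power_law [simp]: "space (power_law \<nu>) = UNIV"
  by (simp_all add: power_law_def)

lemma emeasure_power_law: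
  assumes "0 < \<nu>" "0 \<le> x" "x \<le> 1"
  shows "emeasure (power_law \<nu>) {0..<x} = ennreal (x powr \<nu>)"
proof -
  have "((\<lambda>s. \<nu> * s powr (\<nu> - 1)) has_integral (\<nu> * (x powr (\<nu> - 1 + 1) / (\<nu> - 1 + 1)))) {0..x}"
    using assms by (intro has_integral_mult_right has_integral_powr_from_0) auto
  then have "((\<lambda>s. \<nu> * s powr (\<nu> - 1)) has_integral x powr \<nu>) {0<..<x}"
    using assms(1) unfolding has_integral_Icc_iff_Ioo by simp
  then have "((\<lambda>s. if s \<in> {0<..<x} then \<nu> * s powr (\<nu> - 1) else 0) has_integral x powr \<nu>) UNIV"
    by (simp only: has_integral_restrict_UNIV)
  then have *: "(\<integral>\<^sup>+s. ennreal (if s \<in> {0<..<x} then \<nu> * s powr (\<nu> - 1) else 0) \<partial>lborel) = ennreal (x powr \<nu>)"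
    using assms(1) by (intro nn_integral_has_integral_lborel) auto
  have "emeasure (power_law \<nu>) {0..<x}
      = (\<integral>\<^sup>+s. ennreal (indicator {0<..<1} s * (\<nu> * s powr (\<nu> - 1))) * indicator {0..<x} s \<partial>lborel)"
    unfolding power_law_def by (intro emeasure_density) auto
  also have "\<dots> = (\<integral>\<^sup>+s. ennreal (if s \<in> {0<..<x} then \<nu> * s powr (\<nu> - 1) else 0) \<partial>lborel)"
    using assms by (intro nn_integral_cong) (auto simp: indicator_def)
  finally show ?thesis using * by simp
qed

lemma prob_space_power_law:
  assumes "0 < \<nu>"
  shows "prob_space (power_law \<nu>)"
proof
  have "emeasure (power_law \<nu>) (space (power_law \<nu>)) = emeasure (power_law \<nu>) {0..<1}"
    unfolding power_law_def
    by (simp add: emeasure_density) (intro nn_integral_cong, auto simp: indicator_def)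
  then show "emeasure (power_law \<nu>) (space (power_law \<nu>)) = 1"
    using emeasure_power_law[OF assms, of 1] by simp
qed

lemma AE_power_law: "AE s in power_law \<nu>. s \<in> {0<..<1}"
  unfolding power_law_def by (subst AE_density) (auto simp: indicator_def)

lemma measure_power_law_interval:
  assumes "0 < \<nu>" "0 \<le> a" "a \<le> b" "b \<le> 1"
  shows "measure (power_law \<nu>) {a..<b} = b powr \<nu> - a powr \<nu>"
proof -
  interpret prob_space "power_law \<nu>" by (rule prob_space_power_law[OF assms(1)])
  have "{a..<b} = {0..<b} - {0..<a}" using assms by auto
  then have "measure (power_law \<nu>) {a..<b} = measure (power_law \<nu>) {0..<b} - measure (power_law \<nu>) {0..<a}"
    using assms finite_measure_Diff[of "{0..<b}" "{0..<a}"] by (simp only: sets_power_law) auto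
  also have "\<dots> = b powr \<nu> - a powr \<nu>"
    using assms emeasure_power_law[OF assms(1), of a] emeasure_power_law[OF assms(1), of b]
    by (simp add: measure_def)
  finally show ?thesis .
qed

text \<open>
  The covariance of \<open>B\<^sub>H(1-s)\<close> and \<open>B\<^sub>H(1-t)\<close>, for \<open>s\<close> and \<open>t\<close> in \<open>[0,1]\<close>.
\<close>
definition fbm_kernel :: "real \<Rightarrow> real \<Rightarrow> real \<Rightarrow> real" where
  "fbm_kernel H s t = ((1 - s) powr (2 * H) + (1 - t) powr (2 * H) - \<bar>s - t\<bar> powr (2 * H)) / 2"

text \<open>
  For every exponent the kernel is positive for an elementary reason: \<open>\<bar>s-t\<bar>\<close> is at most the larger of \<open>1-s\<close> and
  \<open>1-t\<close>, so the subtracted power is dominated by one of the other two.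
\<close>
lemma fbm_kernel_bounds:
  assumes "0 < H" "s \<in> {0..1}" "t \<in> {0..1}"
  shows "0 \<le> fbm_kernel H s t" "fbm_kernel H s t \<le> 1"
    and "s < 1 \<Longrightarrow> t < 1 \<Longrightarrow> 0 < fbm_kernel H s t"
proof -
  define u v w where "u = (1 - s) powr (2 * H)" and "v = (1 - t) powr (2 * H)" and "w = \<bar>s - t\<bar> powr (2 * H)"
  have K: "fbm_kernel H s t = (u + v - w) / 2" by (simp add: fbm_kernel_def u_def v_def w_def)
  have "u \<le> 1" "v \<le> 1" using assms by (auto simp: u_def v_def intro!: powr_le1)
  moreover have nonneg: "0 \<le> u" "0 \<le> v" "0 \<le> w" by (simp_all add: u_def v_def w_def)
  ultimately show "fbm_kernel H s t \<le> 1" unfolding K by simp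
  have "w \<le> (1 - min s t) powr (2 * H)"
    unfolding w_def using assms by (intro powr_mono2) auto
  then have w: "w \<le> u \<or> w \<le> v" by (simp add: u_def v_def min_def split: if_splits)
  then show "0 \<le> fbm_kernel H s t" unfolding K using nonneg by auto
  show "0 < fbm_kernel H s t" if "s < 1" "t < 1"
  proof -
    have "0 < u" "0 < v" using that by (auto simp: u_def v_def)
    then show ?thesis unfolding K using w by auto
  qed
qed

lemma continuous_fbm_kernel:
  assumes "0 < H"
  shows "continuous_on ({0..1} \<times> {0..1}) (\<lambda>(s, t). fbm_kernel H s t)"
  unfolding fbm_kernel_def case_prod_beta
  using assms by (intro continuous_on_divide continuous_on_diff continuous_on_add continuous_on_powr'
     continuous_on_rabs continuous_on_fst continuous_on_snd continuous_on_const continuous_on_id) auto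

lemma measurable_fbm_kernel [measurable]:
  "(\<lambda>x. fbm_kernel H (fst x) (snd x)) \<in> borel_measurable (power_law \<nu> \<Otimes>\<^sub>M power_law \<nu>)"
  unfolding fbm_kernel_def by measurable

lemma AE_power_law_pair:
  assumes "0 < \<nu>"
  shows "AE x in power_law \<nu> \<Otimes>\<^sub>M power_law \<nu>. fst x \<in> {0<..<1} \<and> snd x \<in> {0<..<1}"
proof -
  interpret prob_space "power_law \<nu>" by (rule prob_space_power_law[OF assms])
  interpret pair_prob_space "power_law \<nu>" "power_law \<nu>" ..
  have "AE s in power_law \<nu>. AE t in power_law \<nu>. s \<in> {0<..<1} \<and> t \<in> {0<..<1}"
    using AE_power_law by eventually_elim (use AE_power_law in \<open>eventually_elim, blast\<close>)
  moreover have "{x \<in> space (power_law \<nu> \<Otimes>\<^sub>M power_law \<nu>). fst x \<in> {0<..<1} \<and> snd x \<in> {0<..<1}}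
      = {0<..<1} \<times> {0<..<1}" by (auto simp: space_pair_measure)
  ultimately show ?thesis by (subst AE_pair_iff[symmetric]) auto
qed

lemma lattice_indicator:
  assumes "0 < N" "0 \<le> s"
  shows "indicator {real p / real N..<real (Suc p) / real N} s = (if p = nat \<lfloor>real N * s\<rfloor> then 1 else 0 :: real)"
proof -
  have "s \<in> {real p / real N..<real (Suc p) / real N} \<longleftrightarrow> real p \<le> real N * s \<and> real N * s < real p + 1"
    using assms by (auto simp: field_simps)
  also have "\<dots> \<longleftrightarrow> p = nat \<lfloor>real N * s\<rfloor>"
  proof -
    have "0 \<le> real N * s" using assms by simp
    then show ?thesis by linarith
  qed
  finally show ?thesis by (simp add: indicator_def)
qed

lemma double_sum_delta:
  fixes f :: "nat \<Rightarrow> nat \<Rightarrow> real"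
  assumes "a < N" "b < N"
  shows "(\<Sum>p<N. \<Sum>q<N. f p q * ((if p = a then 1 else 0) * (if q = b then 1 else 0))) = f a b"
proof -
  have "(\<Sum>q<N. f p q * ((if p = a then 1 else 0) * (if q = b then 1 else 0))) = (if p = a then f p b else 0)" for p
    using assms by (cases "p = a") (simp_all add: if_distrib[of "\<lambda>y. f _ _ * y"] sum.delta cong: if_cong)
  then show ?thesis using assms by (simp add: sum.delta)
qed

text \<open>
  The block sums are the integrals of the kernel evaluated at the lower left corners of the lattice cells,
  which are step functions converging pointwise to the kernel, with bound \<open>1\<close>.
\<close>
lemma power_law_block_sums:
  assumes \<nu>: "0 < \<nu>" and H: "0 < H"
  shows "(\<lambda>N. \<Sum>p<N. \<Sum>q<N. ((real (Suc p) / real N) powr \<nu> - (real p / real N) powr \<nu>)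
       * ((real (Suc q) / real N) powr \<nu> - (real q / real N) powr \<nu>) * fbm_kernel H (real p / real N) (real q / real N))
    \<longlonglongrightarrow> (\<integral>x. fbm_kernel H (fst x) (snd x) \<partial>(power_law \<nu> \<Otimes>\<^sub>M power_law \<nu>))"
proof -
  let ?\<mu> = "power_law \<nu>"
  interpret prob_space ?\<mu> by (rule prob_space_power_law[OF \<nu>])
  interpret PP: pair_prob_space ?\<mu> ?\<mu> ..
  let ?I = "\<lambda>N p. {real p / real N..<real (Suc p) / real N}"
  define g where "g N x = (\<Sum>p<N. \<Sum>q<N. fbm_kernel H (real p / real N) (real q / real N) *
      indicator (?I N p \<times> ?I N q) x)" for N and x :: "real \<times> real"
  have rect: "?I N p \<times> ?I N q \<in> sets (?\<mu> \<Otimes>\<^sub>M ?\<mu>)" for N p q by simp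
  have meas: "g N \<in> borel_measurable (?\<mu> \<Otimes>\<^sub>M ?\<mu>)" for N
    unfolding g_def using rect by measurable
  have g_int: "integral\<^sup>L (?\<mu> \<Otimes>\<^sub>M ?\<mu>) (g N) = (\<Sum>p<N. \<Sum>q<N. ((real (Suc p) / real N) powr \<nu> - (real p / real N) powr \<nu>)
       * ((real (Suc q) / real N) powr \<nu> - (real q / real N) powr \<nu>) * fbm_kernel H (real p / real N) (real q / real N))" for N
  proof -
    have "measure (?\<mu> \<Otimes>\<^sub>M ?\<mu>) (?I N p \<times> ?I N q) = ((real (Suc p) / real N) powr \<nu> - (real p / real N) powr \<nu>)
       * ((real (Suc q) / real N) powr \<nu> - (real q / real N) powr \<nu>)" if "p < N" "q < N" for p q
    proof -
      have "measure (?\<mu> \<Otimes>\<^sub>M ?\<mu>) (?I N p \<times> ?I N q) = measure ?\<mu> (?I N p) * measure ?\<mu> (?I N q)"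
        by (simp add: measure_def emeasure_pair_measure_Times enn2real_mult)
      also have "\<dots> = ((real (Suc p) / real N) powr \<nu> - (real p / real N) powr \<nu>)
       * ((real (Suc q) / real N) powr \<nu> - (real q / real N) powr \<nu>)"
        using that \<nu> by (subst (1 2) measure_power_law_interval) (auto simp: divide_right_mono)
      finally show ?thesis .
    qed
    moreover have "integral\<^sup>L (?\<mu> \<Otimes>\<^sub>M ?\<mu>) (g N) = (\<Sum>p<N. \<Sum>q<N. fbm_kernel H (real p / real N) (real q / real N) *
        measure (?\<mu> \<Otimes>\<^sub>M ?\<mu>) (?I N p \<times> ?I N q))"
    proof -
      have int: "integrable (?\<mu> \<Otimes>\<^sub>M ?\<mu>) (\<lambda>x. fbm_kernel H (real p / real N) (real q / real N) *
         indicator (?I N p \<times> ?I N q) x)" for p q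
        using rect by (intro integrable_mult_right integrable_real_indicator) (auto simp: less_top[symmetric])
      have ind: "(\<integral>x. indicator (?I N p \<times> ?I N q) x \<partial>(?\<mu> \<Otimes>\<^sub>M ?\<mu>)) = measure (?\<mu> \<Otimes>\<^sub>M ?\<mu>) (?I N p \<times> ?I N q)" for p q
        by (simp add: space_pair_measure)
      have "integral\<^sup>L (?\<mu> \<Otimes>\<^sub>M ?\<mu>) (g N) = (\<Sum>p<N. \<Sum>q<N. \<integral>x. fbm_kernel H (real p / real N) (real q / real N) *
         indicator (?I N p \<times> ?I N q) x \<partial>(?\<mu> \<Otimes>\<^sub>M ?\<mu>))"
        unfolding g_def by (simp only: Bochner_Integration.integral_sum Bochner_Integration.integrable_sum int)
      then show ?thesis by (simp only: integral_mult_right_zero ind)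
    qed
    ultimately show ?thesis by (simp add: mult_ac)
  qed
  have g_eq: "g N x = fbm_kernel H (real (nat \<lfloor>real N * fst x\<rfloor>) / real N) (real (nat \<lfloor>real N * snd x\<rfloor>) / real N)"
    and cell: "real (nat \<lfloor>real N * fst x\<rfloor>) / real N \<in> {0..1}" "real (nat \<lfloor>real N * snd x\<rfloor>) / real N \<in> {0..1}"
    if x: "fst x \<in> {0<..<1}" "snd x \<in> {0<..<1}" and N: "0 < N" for N x
  proof -
    have b: "nat \<lfloor>real N * s\<rfloor> < N" if "s \<in> {0<..<1}" for s
    proof -
      have "real N * s < real N * 1" "0 \<le> real N * s" using that N by (auto intro: mult_strict_left_mono)
      then show ?thesis by linarith
    qed
    have c: "real a / real N \<in> {0..1}" if "a < N" for a :: nat using that by simp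
    have "indicator (?I N p \<times> ?I N q) x = (if p = nat \<lfloor>real N * fst x\<rfloor> then 1 else 0) *
        (if q = nat \<lfloor>real N * snd x\<rfloor> then 1 else 0 :: real)" for p q
      using lattice_indicator[OF N, of "fst x" p] lattice_indicator[OF N, of "snd x" q] x
      unfolding indicator_times by simp
    then show "g N x = fbm_kernel H (real (nat \<lfloor>real N * fst x\<rfloor>) / real N) (real (nat \<lfloor>real N * snd x\<rfloor>) / real N)"
      unfolding g_def using double_sum_delta[OF b[OF x(1)] b[OF x(2)]] by (simp only:)
    show "real (nat \<lfloor>real N * fst x\<rfloor>) / real N \<in> {0..1}" "real (nat \<lfloor>real N * snd x\<rfloor>) / real N \<in> {0..1}"
      using b[OF x(1)] b[OF x(2)] c by blast+
  qed
  have "(\<lambda>N. integral\<^sup>L (?\<mu> \<Otimes>\<^sub>M ?\<mu>) (g N)) \<longlonglongrightarrow> (\<integral>x. fbm_kernel H (fst x) (snd x) \<partial>(?\<mu> \<Otimes>\<^sub>M ?\<mu>))"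
  proof (rule integral_dominated_convergence[where w = "\<lambda>_. 1"])
    show "AE x in ?\<mu> \<Otimes>\<^sub>M ?\<mu>. (\<lambda>N. g N x) \<longlonglongrightarrow> fbm_kernel H (fst x) (snd x)"
      using AE_power_law_pair[OF \<nu>]
    proof eventually_elim
      case (elim x)
      have fl: "(\<lambda>N. real (nat \<lfloor>real N * s\<rfloor>) / real N) \<longlonglongrightarrow> s" if "0 < s" for s
      proof (rule real_tendsto_sandwich)
        have "real N * s - 1 \<le> real (nat \<lfloor>real N * s\<rfloor>)" "real (nat \<lfloor>real N * s\<rfloor>) \<le> real N * s" for N
          using that by auto
        then show "\<forall>\<^sub>F N in sequentially. s - 1 / real N \<le> real (nat \<lfloor>real N * s\<rfloor>) / real N"
          "\<forall>\<^sub>F N in sequentially. real (nat \<lfloor>real N * s\<rfloor>) / real N \<le> s"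
          by (auto intro!: eventually_sequentiallyI[of 1] simp: field_simps)
        show "(\<lambda>N. s - 1 / real N) \<longlonglongrightarrow> s" using tendsto_diff[OF tendsto_const lim_1_over_n, of s] by simp
      qed simp
      have "(\<lambda>N. case (real (nat \<lfloor>real N * fst x\<rfloor>) / real N, real (nat \<lfloor>real N * snd x\<rfloor>) / real N) of (s, t) \<Rightarrow> fbm_kernel H s t)
          \<longlonglongrightarrow> (case (fst x, snd x) of (s, t) \<Rightarrow> fbm_kernel H s t)"
      proof (rule continuous_on_tendsto_compose[OF continuous_fbm_kernel[OF H]])
        show "(\<lambda>N. (real (nat \<lfloor>real N * fst x\<rfloor>) / real N, real (nat \<lfloor>real N * snd x\<rfloor>) / real N)) \<longlonglongrightarrow> (fst x, snd x)"
          using elim fl by (intro tendsto_Pair) auto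
        show "\<forall>\<^sub>F N in sequentially. (real (nat \<lfloor>real N * fst x\<rfloor>) / real N, real (nat \<lfloor>real N * snd x\<rfloor>) / real N) \<in> {0..1} \<times> {0..1}"
          using eventually_gt_at_top[of 0] by eventually_elim (use cell elim in blast)
      qed (use elim in \<open>auto simp: mem_Times_iff\<close>)
      moreover have "\<forall>\<^sub>F N in sequentially. (case (real (nat \<lfloor>real N * fst x\<rfloor>) / real N, real (nat \<lfloor>real N * snd x\<rfloor>) / real N) of (s, t) \<Rightarrow> fbm_kernel H s t) = g N x"
        using eventually_gt_at_top[of 0] by eventually_elim (use g_eq elim in auto)
      ultimately show ?case unfolding prod.case by (rule Lim_transform_eventually)
    qed
    show "AE x in ?\<mu> \<Otimes>\<^sub>M ?\<mu>. norm (g N x) \<le> 1" for N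
      using AE_power_law_pair[OF \<nu>]
    proof eventually_elim
      case (elim x)
      show ?case
      proof (cases "N = 0")
        case True
        then show ?thesis by (simp add: g_def)
      next
        case False
        then show ?thesis
          using g_eq[of x N] cell[of x N] fbm_kernel_bounds(1,2)[OF H] elim by simp
      qed
    qed
  qed (use meas in \<open>auto intro!: measurable_fbm_kernel\<close>)
  then show ?thesis by (simp only: g_int)
qed

lemma integral_fbm_kernel_pos:
  assumes \<nu>: "0 < \<nu>" and H: "0 < H"
  shows "0 < (\<integral>x. fbm_kernel H (fst x) (snd x) \<partial>(power_law \<nu> \<Otimes>\<^sub>M power_law \<nu>))"
proof -
  let ?\<mu> = "power_law \<nu>"
  interpret prob_space ?\<mu> by (rule prob_space_power_law[OF \<nu>])
  interpret PP: pair_prob_space ?\<mu> ?\<mu> ..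
  note AE = AE_power_law_pair[OF \<nu>]
  have bounds: "0 < fbm_kernel H (fst x) (snd x)" "fbm_kernel H (fst x) (snd x) \<le> 1"
    if "fst x \<in> {0<..<1} \<and> snd x \<in> {0<..<1}" for x
    using fbm_kernel_bounds[OF H, of "fst x" "snd x"] that by auto
  have bd: "AE x in ?\<mu> \<Otimes>\<^sub>M ?\<mu>. norm (fbm_kernel H (fst x) (snd x)) \<le> 1 \<and>
      0 \<le> fbm_kernel H (fst x) (snd x) \<and> fbm_kernel H (fst x) (snd x) \<noteq> 0"
    using AE
  proof eventually_elim
    case (elim x)
    show ?case using bounds[OF elim] by simp
  qed
  then have bd: "AE x in ?\<mu> \<Otimes>\<^sub>M ?\<mu>. norm (fbm_kernel H (fst x) (snd x)) \<le> 1"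
    and nn: "AE x in ?\<mu> \<Otimes>\<^sub>M ?\<mu>. 0 \<le> fbm_kernel H (fst x) (snd x)"
    and ps: "AE x in ?\<mu> \<Otimes>\<^sub>M ?\<mu>. fbm_kernel H (fst x) (snd x) \<noteq> 0"
    by (simp_all only: eventually_conj_iff)
  have int: "integrable (?\<mu> \<Otimes>\<^sub>M ?\<mu>) (\<lambda>x. fbm_kernel H (fst x) (snd x))"
    using bd by (rule PP.integrable_const_bound) (rule measurable_fbm_kernel)
  have "(\<integral>x. fbm_kernel H (fst x) (snd x) \<partial>(?\<mu> \<Otimes>\<^sub>M ?\<mu>)) \<noteq> 0"
  proof
    assume "(\<integral>x. fbm_kernel H (fst x) (snd x) \<partial>(?\<mu> \<Otimes>\<^sub>M ?\<mu>)) = 0"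
    then have "AE x in ?\<mu> \<Otimes>\<^sub>M ?\<mu>. fbm_kernel H (fst x) (snd x) = 0"
      using integral_nonneg_eq_0_iff_AE[OF int nn] by simp
    then have "AE x in ?\<mu> \<Otimes>\<^sub>M ?\<mu>. False" using ps by eventually_elim simp
    then show False by simp
  qed
  moreover have "0 \<le> (\<integral>x. fbm_kernel H (fst x) (snd x) \<partial>(?\<mu> \<Otimes>\<^sub>M ?\<mu>))"
    using nn by (rule integral_nonneg_AE)
  ultimately show ?thesis by simp
qed

section \<open>The variance of the limit process\<close>

lemma fbm_measurable:
  assumes "fractional_brownian_motion H Q B" "0 \<le> t"
  shows "B t \<in> borel_measurable Q"
proof -
  have "gaussian_process Q {0..} B" using assms(1) by (simp add: fractional_brownian_motion_def)
  then have "gaussian_rv Q (\<lambda>\<omega>. \<Sum>t\<in>{t}. 1 * B t \<omega>)"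
    unfolding gaussian_process_def using assms(2) by (elim allE[of _ "{t}"] allE[of _ "\<lambda>_. 1"]) auto
  then show ?thesis by (simp add: gaussian_rv_def)
qed

text \<open>
  Cutting off to the open unit interval makes this a function on the whole real line with second moments
  everywhere. The value of \<open>B\<close> at time \<open>0\<close> is avoided because a vanishing integral of \<open>B(0)\<^sup>2\<close>
  says nothing about its integrability.
\<close>
definition reversed_path :: "(real \<Rightarrow> 'b \<Rightarrow> real) \<Rightarrow> real \<Rightarrow> 'b \<Rightarrow> real" where
  "reversed_path B s \<omega> = indicator {0<..<1} s * B (1 - s) \<omega>"

text \<open>
  Joint measurability comes from continuity of the paths: rounding the time up to a multiple of \<open>1/n\<close>
  leaves countably many random variables, and the rounded paths converge pointwise.
\<close>
lemma measurable_reversed_path: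
  assumes fbm: "fractional_brownian_motion H Q B"
  shows "(\<lambda>x. reversed_path B (fst x) (snd x)) \<in> borel_measurable (borel \<Otimes>\<^sub>M Q)"
proof (rule borel_measurable_LIMSEQ_real)
  define u where "u n x = indicator {0<..<1} (fst x) * B (real (nat \<lceil>(1 - fst x) * real n\<rceil>) / real n) (snd x)"
    for n and x :: "real \<times> 'a"
  show "u n \<in> borel_measurable (borel \<Otimes>\<^sub>M Q)" for n
  proof -
    have "(\<lambda>x. B (real k / real n) (snd x)) \<in> borel_measurable (borel \<Otimes>\<^sub>M Q)" for k
      using fbm_measurable[OF fbm, of "real k / real n"] by measurable
    moreover have "(\<lambda>x. nat \<lceil>(1 - fst x) * real n\<rceil>) \<in> measurable (borel \<Otimes>\<^sub>M Q) (count_space UNIV)"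
      by measurable
    ultimately have "(\<lambda>x. B (real (nat \<lceil>(1 - fst x) * real n\<rceil>) / real n) (snd x)) \<in> borel_measurable (borel \<Otimes>\<^sub>M Q)"
      by (rule measurable_compose_countable)
    then show ?thesis unfolding u_def by measurable
  qed
  fix x :: "real \<times> 'a" assume "x \<in> space (borel \<Otimes>\<^sub>M Q)"
  then have cont: "continuous_on {0..} (\<lambda>t. B t (snd x))"
    using fbm by (auto simp: fractional_brownian_motion_def space_pair_measure)
  show "(\<lambda>n. u n x) \<longlonglongrightarrow> reversed_path B (fst x) (snd x)"
  proof (cases "fst x \<in> {0<..<1}")
    case False
    then show ?thesis by (simp add: u_def reversed_path_def)
  next
    case True
    then have c: "0 < 1 - fst x" by simp
    have "(\<lambda>n. real (nat \<lceil>(1 - fst x) * real n\<rceil>) / real n) \<longlonglongrightarrow> 1 - fst x"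
    proof (rule real_tendsto_sandwich)
      have b: "(1 - fst x) * real n \<le> real (nat \<lceil>(1 - fst x) * real n\<rceil>)"
        "real (nat \<lceil>(1 - fst x) * real n\<rceil>) \<le> (1 - fst x) * real n + 1" for n
      proof -
        have "0 \<le> (1 - fst x) * real n" using c by simp
        then show "(1 - fst x) * real n \<le> real (nat \<lceil>(1 - fst x) * real n\<rceil>)"
        "real (nat \<lceil>(1 - fst x) * real n\<rceil>) \<le> (1 - fst x) * real n + 1" by linarith+
      qed
      show "\<forall>\<^sub>F n in sequentially. 1 - fst x \<le> real (nat \<lceil>(1 - fst x) * real n\<rceil>) / real n"
        using b(1) by (intro eventually_sequentiallyI[of 1]) (simp only: pos_le_divide_eq of_nat_0_less_iff)
      show "\<forall>\<^sub>F n in sequentially. real (nat \<lceil>(1 - fst x) * real n\<rceil>) / real n \<le> 1 - fst x + 1 / real n"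
      proof (rule eventually_sequentiallyI[of 1])
        fix n :: nat assume "1 \<le> n"
        then have "real (nat \<lceil>(1 - fst x) * real n\<rceil>) / real n \<le> ((1 - fst x) * real n + 1) / real n"
          by (intro divide_right_mono b) auto
        also have "\<dots> = 1 - fst x + 1 / real n" using \<open>1 \<le> n\<close> by (simp add: add_divide_distrib)
        finally show "real (nat \<lceil>(1 - fst x) * real n\<rceil>) / real n \<le> 1 - fst x + 1 / real n" .
      qed
      show "(\<lambda>n. 1 - fst x + 1 / real n) \<longlonglongrightarrow> 1 - fst x"
        using tendsto_add[OF tendsto_const lim_1_over_n, of "1 - fst x"] by simp
    qed simp
    then have "(\<lambda>n. B (real (nat \<lceil>(1 - fst x) * real n\<rceil>) / real n) (snd x)) \<longlonglongrightarrow> B (1 - fst x) (snd x)"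
      by (rule continuous_on_tendsto_compose[OF cont])
        (use c in \<open>simp_all only: atLeast_iff divide_nonneg_nonneg of_nat_0_le_iff less_imp_le eventually_True\<close>)
    then show ?thesis using True by (simp add: u_def reversed_path_def)
  qed
qed

lemma reversed_path_moments:
  assumes fbm: "fractional_brownian_motion H Q B"
  shows "square_integrable Q (reversed_path B s)"
    and "(\<integral>\<omega>. reversed_path B s \<omega> \<partial>Q) = 0"
    and "(\<integral>\<omega>. reversed_path B s \<omega> * reversed_path B t \<omega> \<partial>Q) =
      indicator {0<..<1} s * indicator {0<..<1} t * fbm_kernel H s t"
proof -
  have cov: "(\<integral>\<omega>. B u \<omega> * B v \<omega> \<partial>Q) = (v powr (2 * H) + u powr (2 * H) - \<bar>v - u\<bar> powr (2 * H)) / 2"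
    and mean: "(\<integral>\<omega>. B u \<omega> \<partial>Q) = 0" if "0 \<le> u" "0 \<le> v" for u v
    using fbm that by (simp_all add: fractional_brownian_motion_def)
  show "square_integrable Q (reversed_path B s)"
  proof (cases "s \<in> {0<..<1}")
    case True
    then have "(\<integral>\<omega>. (B (1 - s) \<omega>)\<^sup>2 \<partial>Q) \<noteq> 0"
      unfolding power2_eq_square by (subst cov) auto
    \<comment> \<open>the integral of a non-integrable function would be 0\<close>
    then have "integrable Q (\<lambda>\<omega>. (B (1 - s) \<omega>)\<^sup>2)"
      using not_integrable_integral_eq by blast
    then show ?thesis
      using True fbm_measurable[OF fbm, of "1 - s"] by (simp add: square_integrable_def reversed_path_def[abs_def])
  qed (simp add: square_integrable_def reversed_path_def[abs_def])
  show "(\<integral>\<omega>. reversed_path B s \<omega> \<partial>Q) = 0"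
    unfolding reversed_path_def using mean[of "1 - s" 0] by (simp add: indicator_def)
  show "(\<integral>\<omega>. reversed_path B s \<omega> * reversed_path B t \<omega> \<partial>Q) =
      indicator {0<..<1} s * indicator {0<..<1} t * fbm_kernel H s t"
    using cov[of "1 - s" "1 - t"]
    by (auto simp: reversed_path_def indicator_def fbm_kernel_def add.commute)
qed

text \<open>
  The interval of integration and the open interval carrying the power law differ by the two endpoints only.
\<close>
lemma Z_proc_eq_integral:
  assumes fbm: "fractional_brownian_motion H Q B" and \<nu>: "0 < \<nu>" and \<omega>: "\<omega> \<in> space Q"
  shows "Z_proc \<nu> B 1 \<omega> = (\<integral>s. reversed_path B s \<omega> \<partial>power_law \<nu>)"
proof -
  have cont: "continuous_on {0..} (\<lambda>t. B t \<omega>)"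
    using fbm \<omega> by (simp add: fractional_brownian_motion_def)
  have "continuous_on {0..1} (\<lambda>s. B (1 - s) \<omega>)"
    by (intro continuous_on_compose2[OF cont] continuous_intros) auto
  then have m1: "(\<lambda>s. indicator {0..1} s *\<^sub>R B (1 - s) \<omega>) \<in> borel_measurable borel"
    by (intro borel_measurable_continuous_on_indicator) auto
  have m2: "(\<lambda>s. reversed_path B s \<omega>) \<in> borel_measurable borel"
    using measurable_Pair1[OF measurable_reversed_path[OF fbm] \<omega>] by simp
  have "Z_proc \<nu> B 1 \<omega> = (\<integral>s. \<nu> * ((indicator {0..1} s *\<^sub>R B (1 - s) \<omega>) * s powr (\<nu> - 1)) \<partial>lborel)"
    by (simp add: Z_proc_def set_lebesgue_integral_def mult.assoc)
  also have "\<dots> = (\<integral>s. indicator {0<..<1} s * (\<nu> * s powr (\<nu> - 1)) * reversed_path B s \<omega> \<partial>lborel)"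
  proof (rule integral_cong_AE)
    show "AE s in lborel. \<nu> * ((indicator {0..1} s *\<^sub>R B (1 - s) \<omega>) * s powr (\<nu> - 1)) =
        indicator {0<..<1} s * (\<nu> * s powr (\<nu> - 1)) * reversed_path B s \<omega>"
      using AE_lborel_singleton[of 0] AE_lborel_singleton[of 1]
      by eventually_elim (auto simp: reversed_path_def indicator_def)
  qed (use m1 m2 in measurable)
  also have "\<dots> = (\<integral>s. reversed_path B s \<omega> \<partial>power_law \<nu>)"
    unfolding power_law_def using m2 \<nu> by (subst integral_density) auto
  finally show ?thesis .
qed

text \<open>
  The square of an integral over \<open>s\<close> is an integral over pairs \<open>(s, t)\<close>; Fubini's theorem moves the
  expectation inside, where it is the covariance. The required integrability follows from
  \<open>\<bar>x y\<bar> \<le> (x\<^sup>2 + y\<^sup>2) / 2\<close> and the bound \<open>1\<close> for the second moments.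
\<close>
lemma variance_Z_proc:
  assumes fbm: "fractional_brownian_motion H Q B" and \<nu>: "0 < \<nu>" and H: "0 < H"
  shows "prob_space.variance Q (Z_proc \<nu> B 1)
    = (\<integral>x. fbm_kernel H (fst x) (snd x) \<partial>(power_law \<nu> \<Otimes>\<^sub>M power_law \<nu>))"
proof -
  let ?\<mu> = "power_law \<nu>" and ?C = "reversed_path B"
  interpret prob_space Q using fbm by (simp add: fractional_brownian_motion_def)
  interpret M: prob_space ?\<mu> by (rule prob_space_power_law[OF \<nu>])
  interpret MM: pair_prob_space ?\<mu> ?\<mu> ..
  interpret MQ: pair_prob_space ?\<mu> Q ..
  interpret MMQ: pair_prob_space "?\<mu> \<Otimes>\<^sub>M ?\<mu>" Q ..
  note sq = reversed_path_moments(1)[OF fbm] and mean = reversed_path_moments(2)[OF fbm]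
    and cov = reversed_path_moments(3)[OF fbm]
  have Z: "Z_proc \<nu> B 1 \<omega> = (\<integral>s. ?C s \<omega> \<partial>?\<mu>)" if "\<omega> \<in> space Q" for \<omega>
    using Z_proc_eq_integral[OF fbm \<nu> that] .
  have meas: "(\<lambda>x. ?C (fst x) (snd x)) \<in> borel_measurable (borel \<Otimes>\<^sub>M Q)"
    by (rule measurable_reversed_path[OF fbm])
  have second: "expectation (\<lambda>\<omega>. (?C s \<omega>)\<^sup>2) \<le> 1" for s
    unfolding power2_eq_square cov using fbm_kernel_bounds(2)[OF H, of s s] by (auto simp: indicator_def)
  have abs_le: "expectation (\<lambda>\<omega>. norm (f \<omega> * g \<omega>)) \<le> (expectation (\<lambda>\<omega>. (f \<omega>)\<^sup>2) + expectation (\<lambda>\<omega>. (g \<omega>)\<^sup>2)) / 2"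
    if "square_integrable Q f" "square_integrable Q g" for f g
  proof -
    have "norm (x * y) \<le> (x\<^sup>2 + y\<^sup>2) / 2" for x y :: real
      using sum_squares_bound[of "\<bar>x\<bar>" "\<bar>y\<bar>"] by (simp add: abs_mult)
    then have "expectation (\<lambda>\<omega>. norm (f \<omega> * g \<omega>)) \<le> expectation (\<lambda>\<omega>. ((f \<omega>)\<^sup>2 + (g \<omega>)\<^sup>2) / 2)"
      using that integrable_mult_square_integrable[OF that]
      by (intro integral_mono) (auto simp: square_integrable_def)
    also have "\<dots> = (expectation (\<lambda>\<omega>. (f \<omega>)\<^sup>2) + expectation (\<lambda>\<omega>. (g \<omega>)\<^sup>2)) / 2"
      using that by (simp add: square_integrable_def)
    finally show ?thesis .
  qed
  have one: "square_integrable Q (\<lambda>_. 1)" by (simp add: square_integrable_def)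
  have mean_Z: "expectation (Z_proc \<nu> B 1) = 0"
  proof -
    have m: "(\<lambda>y. ?C (fst y) (snd y)) \<in> borel_measurable (?\<mu> \<Otimes>\<^sub>M Q)"
      using meas by (simp cong: measurable_cong_sets sets_pair_measure_cong)
    have "integrable (?\<mu> \<Otimes>\<^sub>M Q) (\<lambda>y. ?C (fst y) (snd y))"
    proof (rule MQ.Fubini_integrable[OF m])
      show "integrable ?\<mu> (\<lambda>s. expectation (\<lambda>\<omega>. norm (?C (fst (s, \<omega>)) (snd (s, \<omega>)))))"
      proof (rule M.integrable_const_bound[of _ 1])
        have "expectation (\<lambda>\<omega>. norm (?C s \<omega>)) \<le> 1" for s
          using abs_le[OF sq[of s] one] second[of s] by (simp add: prob_space)
        then show "AE s in ?\<mu>. norm (expectation (\<lambda>\<omega>. norm (?C (fst (s, \<omega>)) (snd (s, \<omega>))))) \<le> 1" by simp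
        show "(\<lambda>s. expectation (\<lambda>\<omega>. norm (?C (fst (s, \<omega>)) (snd (s, \<omega>))))) \<in> borel_measurable ?\<mu>"
          using m by measurable
      qed
      show "AE s in ?\<mu>. integrable Q (\<lambda>\<omega>. ?C (fst (s, \<omega>)) (snd (s, \<omega>)))"
        using integrable_mult_square_integrable[OF sq one] by simp
    qed
    then have "expectation (\<lambda>\<omega>. \<integral>s. ?C s \<omega> \<partial>?\<mu>) = (\<integral>s. expectation (\<lambda>\<omega>. ?C s \<omega>) \<partial>?\<mu>)"
      by (intro MQ.Fubini_integral) (simp add: case_prod_unfold)
    also have "\<dots> = 0" using mean by simp
    finally show ?thesis using Z by (simp cong: Bochner_Integration.integral_cong)
  qed
  have product: "(\<integral>x. ?C (fst x) \<omega> * ?C (snd x) \<omega> \<partial>(?\<mu> \<Otimes>\<^sub>M ?\<mu>)) = (\<integral>s. ?C s \<omega> \<partial>?\<mu>)\<^sup>2" if \<omega>: "\<omega> \<in> space Q" for \<omega>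
  proof -
    have m: "(\<lambda>s. ?C s \<omega>) \<in> borel_measurable ?\<mu>"
      using measurable_Pair1[OF meas \<omega>] by (simp cong: measurable_cong_sets)
    have "continuous_on {0..1} (\<lambda>t. B t \<omega>)"
      using fbm \<omega> by (auto simp: fractional_brownian_motion_def intro: continuous_on_subset)
    then have "bounded ((\<lambda>t. B t \<omega>) ` {0..1})" by (intro compact_imp_bounded compact_continuous_image) auto
    then obtain K where "0 < K" and K: "\<And>t. t \<in> {0..1} \<Longrightarrow> \<bar>B t \<omega>\<bar> \<le> K"
      by (auto simp: bounded_pos)
    then have CK: "\<bar>?C s \<omega>\<bar> \<le> K" for s by (auto simp: reversed_path_def indicator_def)
    have "norm (?C (fst x) \<omega> * ?C (snd x) \<omega>) \<le> K * K" for x :: "real \<times> real"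
      unfolding real_norm_def abs_mult using CK \<open>0 < K\<close> by (intro mult_mono) auto
    then have "integrable (?\<mu> \<Otimes>\<^sub>M ?\<mu>) (\<lambda>x. ?C (fst x) \<omega> * ?C (snd x) \<omega>)"
      using m by (intro MM.integrable_const_bound[of _ "K * K"]) (auto, measurable)
    from MM.integral_fst'[OF this] show ?thesis by (simp add: power2_eq_square)
  qed
  have "integrable ((?\<mu> \<Otimes>\<^sub>M ?\<mu>) \<Otimes>\<^sub>M Q) (\<lambda>y. ?C (fst (fst y)) (snd y) * ?C (snd (fst y)) (snd y))"
  proof -
    have m: "(\<lambda>y. ?C (fst (fst y)) (snd y)) \<in> borel_measurable ((?\<mu> \<Otimes>\<^sub>M ?\<mu>) \<Otimes>\<^sub>M Q)"
      "(\<lambda>y. ?C (snd (fst y)) (snd y)) \<in> borel_measurable ((?\<mu> \<Otimes>\<^sub>M ?\<mu>) \<Otimes>\<^sub>M Q)"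
      using measurable_compose[OF _ meas, of "\<lambda>y. (fst (fst y), snd y)" "(?\<mu> \<Otimes>\<^sub>M ?\<mu>) \<Otimes>\<^sub>M Q"]
        measurable_compose[OF _ meas, of "\<lambda>y. (snd (fst y), snd y)" "(?\<mu> \<Otimes>\<^sub>M ?\<mu>) \<Otimes>\<^sub>M Q"] by simp_all
    have m': "(\<lambda>y. ?C (fst (fst y)) (snd y) * ?C (snd (fst y)) (snd y)) \<in> borel_measurable ((?\<mu> \<Otimes>\<^sub>M ?\<mu>) \<Otimes>\<^sub>M Q)"
      using m by measurable
    show ?thesis
    proof (rule MMQ.Fubini_integrable[OF m'])
      show "integrable (?\<mu> \<Otimes>\<^sub>M ?\<mu>) (\<lambda>x. expectation (\<lambda>\<omega>. norm
          (?C (fst (fst (x, \<omega>))) (snd (x, \<omega>)) * ?C (snd (fst (x, \<omega>))) (snd (x, \<omega>)))))"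
      proof (rule MM.integrable_const_bound[of _ 1])
        have "expectation (\<lambda>\<omega>. norm (?C s \<omega> * ?C t \<omega>)) \<le> 1" for s t
          by (rule order_trans[OF abs_le[OF sq sq]]) (use second[of s] second[of t] in simp)
        then show "AE x in ?\<mu> \<Otimes>\<^sub>M ?\<mu>. norm (expectation (\<lambda>\<omega>. norm
          (?C (fst (fst (x, \<omega>))) (snd (x, \<omega>)) * ?C (snd (fst (x, \<omega>))) (snd (x, \<omega>))))) \<le> 1" by simp
        show "(\<lambda>x. expectation (\<lambda>\<omega>. norm
          (?C (fst (fst (x, \<omega>))) (snd (x, \<omega>)) * ?C (snd (fst (x, \<omega>))) (snd (x, \<omega>))))) \<in> borel_measurable (?\<mu> \<Otimes>\<^sub>M ?\<mu>)"
          using m' by measurable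
      qed
      show "AE x in ?\<mu> \<Otimes>\<^sub>M ?\<mu>. integrable Q (\<lambda>\<omega>. ?C (fst (fst (x, \<omega>))) (snd (x, \<omega>)) * ?C (snd (fst (x, \<omega>))) (snd (x, \<omega>)))"
        using integrable_mult_square_integrable[OF sq sq] by simp
    qed
  qed
  then have "expectation (\<lambda>\<omega>. \<integral>x. ?C (fst x) \<omega> * ?C (snd x) \<omega> \<partial>(?\<mu> \<Otimes>\<^sub>M ?\<mu>))
      = (\<integral>x. expectation (\<lambda>\<omega>. ?C (fst x) \<omega> * ?C (snd x) \<omega>) \<partial>(?\<mu> \<Otimes>\<^sub>M ?\<mu>))"
    by (intro MMQ.Fubini_integral) (simp add: case_prod_unfold)
  moreover have "expectation (\<lambda>\<omega>. \<integral>x. ?C (fst x) \<omega> * ?C (snd x) \<omega> \<partial>(?\<mu> \<Otimes>\<^sub>M ?\<mu>)) = expectation (\<lambda>\<omega>. (Z_proc \<nu> B 1 \<omega>)\<^sup>2)"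
    using product Z by (intro Bochner_Integration.integral_cong) auto
  moreover have "(\<integral>x. expectation (\<lambda>\<omega>. ?C (fst x) \<omega> * ?C (snd x) \<omega>) \<partial>(?\<mu> \<Otimes>\<^sub>M ?\<mu>))
      = (\<integral>x. fbm_kernel H (fst x) (snd x) \<partial>(?\<mu> \<Otimes>\<^sub>M ?\<mu>))"
    unfolding cov
  proof (rule integral_cong_AE)
    show "AE x in ?\<mu> \<Otimes>\<^sub>M ?\<mu>. indicator {0<..<1} (fst x) * indicator {0<..<1} (snd x) * fbm_kernel H (fst x) (snd x)
        = fbm_kernel H (fst x) (snd x)"
      using AE_power_law_pair[OF \<nu>] by eventually_elim auto
  qed (measurable)
  ultimately show ?thesis using variance_mean_zero[OF mean_Z] by simp
qed

section \<open>Asymptotics of the variance\<close>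

lemma power2_powr: "(x powr H)\<^sup>2 = x powr (2 * H)" for x H :: real
  by (simp add: power2_eq_square flip: powr_add)

lemma uniform_regular_variation_square:
  fixes s :: "nat \<Rightarrow> real"
  assumes H: "0 < H"
    and unif: "\<And>\<epsilon>. 0 < \<epsilon> \<Longrightarrow> \<forall>\<^sub>F n in sequentially. \<forall>r\<le>n. \<bar>s r / s n - (real r / real n) powr H\<bar> \<le> \<epsilon>"
    and "0 < \<epsilon>"
  shows "\<forall>\<^sub>F n in sequentially. \<forall>r\<le>n. \<bar>(s r / s n)\<^sup>2 - (real r / real n) powr (2 * H)\<bar> \<le> \<epsilon>"
proof -
  define \<delta> where "\<delta> = min 1 (\<epsilon> / 3)"
  have \<delta>: "0 < \<delta>" "\<delta> \<le> 1" "3 * \<delta> \<le> \<epsilon>" using \<open>0 < \<epsilon>\<close> by (auto simp: \<delta>_def)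
  from unif[OF \<delta>(1)] eventually_gt_at_top[of 0] show ?thesis
  proof eventually_elim
    case (elim n)
    show ?case
    proof (intro allI impI)
      fix r assume "r \<le> n"
      define a b where "a = s r / s n" and "b = (real r / real n) powr H"
      have ab: "\<bar>a - b\<bar> \<le> \<delta>" using elim \<open>r \<le> n\<close> by (auto simp: a_def b_def)
      have "0 \<le> b" "b \<le> 1" using \<open>r \<le> n\<close> elim(2) H by (auto simp: b_def intro!: powr_le1)
      then have "\<bar>a + b\<bar> \<le> 3" using ab \<delta> by linarith
      have "a\<^sup>2 - b\<^sup>2 = (a - b) * (a + b)" by (simp add: power2_eq_square algebra_simps)
      then have "\<bar>a\<^sup>2 - b\<^sup>2\<bar> = \<bar>a - b\<bar> * \<bar>a + b\<bar>" by (simp only: abs_mult)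
      also have "\<dots> \<le> \<delta> * 3" using ab \<open>\<bar>a + b\<bar> \<le> 3\<close> \<delta> by (intro mult_mono) auto
      also have "\<dots> \<le> \<epsilon>" using \<delta> by simp
      finally show "\<bar>(s r / s n)\<^sup>2 - (real r / real n) powr (2 * H)\<bar> \<le> \<epsilon>"
        by (simp only: a_def b_def power2_powr)
    qed
  qed
qed

lemma covariance_kernel_limit:
  fixes \<rho> :: "nat \<Rightarrow> nat \<Rightarrow> real"
  assumes unif: "\<And>\<epsilon>. 0 < \<epsilon> \<Longrightarrow> \<forall>\<^sub>F n in sequentially. \<forall>r\<le>n. \<bar>\<rho> n r - (real r / real n) powr (2 * H)\<bar> \<le> \<epsilon>"
    and "0 < \<epsilon>"
  shows "\<forall>\<^sub>F n in sequentially. \<forall>i<n. \<forall>j<n.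
    \<bar>(\<rho> n (n - i) + \<rho> n (n - j) - \<rho> n (nat \<bar>int i - int j\<bar>)) / 2 - fbm_kernel H (real i / real n) (real j / real n)\<bar> \<le> \<epsilon>"
proof -
  have "0 < \<epsilon> / 2" using \<open>0 < \<epsilon>\<close> by simp
  from unif[OF this] show ?thesis
  proof eventually_elim
    case (elim n)
    show ?case
    proof (intro allI impI)
      fix i j assume ij: "i < n" "j < n"
      have "real (n - i) / real n = 1 - real i / real n" if "i < n" for i
        using that by (simp add: of_nat_diff diff_divide_distrib)
      then have q: "real (n - i) / real n = 1 - real i / real n" "real (n - j) / real n = 1 - real j / real n"
        using ij by blast+
      have "real (nat \<bar>int i - int j\<bar>) = \<bar>real i - real j\<bar>" by simp
      then have q': "real (nat \<bar>int i - int j\<bar>) / real n = \<bar>real i / real n - real j / real n\<bar>"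
        by (simp only: abs_divide abs_of_nat flip: diff_divide_distrib)
      define a b c where "a = (1 - real i / real n) powr (2 * H)" and "b = (1 - real j / real n) powr (2 * H)"
        and "c = \<bar>real i / real n - real j / real n\<bar> powr (2 * H)"
      have d: "n - i \<le> n" "n - j \<le> n" "nat \<bar>int i - int j\<bar> \<le> n" using ij by linarith+
      have "\<bar>(u + v - w) / 2 - (a + b - c) / 2\<bar> \<le> \<epsilon>"
        if "\<bar>u - a\<bar> \<le> \<epsilon> / 2" "\<bar>v - b\<bar> \<le> \<epsilon> / 2" "\<bar>w - c\<bar> \<le> \<epsilon> / 2" for u v w
        using that \<open>0 < \<epsilon>\<close> unfolding add_divide_distrib diff_divide_distrib by linarith
      from this[OF elim[rule_format, OF d(1), unfolded q, folded a_def]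
          elim[rule_format, OF d(2), unfolded q, folded b_def] elim[rule_format, OF d(3), unfolded q', folded c_def]]
      have "\<bar>(\<rho> n (n - i) + \<rho> n (n - j) - \<rho> n (nat \<bar>int i - int j\<bar>)) / 2 - (a + b - c) / 2\<bar> \<le> \<epsilon>" .
      then show "\<bar>(\<rho> n (n - i) + \<rho> n (n - j) - \<rho> n (nat \<bar>int i - int j\<bar>)) / 2
          - fbm_kernel H (real i / real n) (real j / real n)\<bar> \<le> \<epsilon>"
        by (simp only: fbm_kernel_def a_def b_def c_def)
    qed
  qed
qed

context centered_stationary
begin

lemma deviation_uniform_regular_variation:
  assumes H: "0 < H" "H < 1"
    and h: "\<forall>x>0. 0 < h x" "slowly_varying h"
    and var: "\<forall>n\<ge>1. variance (S_sum X n) = (h (real n))\<^sup>2 * real n powr (2 * H)"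
    and "0 < \<epsilon>"
  shows "\<forall>\<^sub>F n in sequentially. \<forall>r\<le>n.
    \<bar>variance (S_sum X r) / variance (S_sum X n) - (real r / real n) powr (2 * H)\<bar> \<le> \<epsilon>"
proof -
  define s where "s n = h (real n) * real n powr H" for n :: nat
  have s2: "variance (S_sum X n) = (s n)\<^sup>2" for n
  proof (cases "n = 0")
    case True
    then show ?thesis by (simp add: s_def S_sum_def[abs_def])
  next
    case False
    then show ?thesis using var by (simp add: s_def power_mult_distrib power2_powr)
  qed
  have pos: "0 < s n" if "0 < n" for n using that h(1) by (simp add: s_def)
  have zero: "s 0 = 0" by (simp add: s_def)
  have s_eq: "sqrt (expectation (\<lambda>\<omega>. (S_sum X n \<omega>)\<^sup>2)) = s n" for n
    using pos[of n] zero unfolding variance_S[symmetric] s2 by (cases "n = 0") auto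
  have incr: "\<bar>s (m + k) - s m\<bar> \<le> s k" for m k
    using S_deviation_increment[of m k] unfolding s_eq .
  have ratio: "(\<lambda>n. s (c * n) / s n) \<longlonglongrightarrow> real c powr H" if "0 < c" for c
  proof -
    have "((\<lambda>x. h (real c * x) / h x) \<longlongrightarrow> 1) at_top"
      using h(2) that by (simp add: slowly_varying_def)
    then have "(\<lambda>n. h (real c * real n) / h (real n)) \<longlonglongrightarrow> 1"
      by (rule filterlim_compose[OF _ filterlim_real_sequentially])
    then have "(\<lambda>n. h (real c * real n) / h (real n) * real c powr H) \<longlonglongrightarrow> 1 * real c powr H"
      by (intro tendsto_mult tendsto_const)
    moreover have "\<forall>\<^sub>F n in sequentially. h (real c * real n) / h (real n) * real c powr H = s (c * n) / s n"
      using eventually_gt_at_top[of 0] by eventually_elim (simp add: s_def powr_mult)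
    ultimately show ?thesis unfolding mult_1_left by (rule Lim_transform_eventually)
  qed
  have "\<forall>\<^sub>F n in sequentially. \<forall>r\<le>n. \<bar>s r / s n - (real r / real n) powr H\<bar> \<le> \<epsilon>" if "0 < \<epsilon>" for \<epsilon>
    using H that by (intro uniform_regular_variation zero pos incr ratio) auto
  from uniform_regular_variation_square[OF H(1) this \<open>0 < \<epsilon>\<close>] show ?thesis
    unfolding s2 power_divide .
qed

text \<open>
  The common part of both regimes. The parameter \<open>r\<close> is the limit of \<open>M(0)/M(n)\<close>, \<open>m\<close> gives the
  limits of the block masses, and \<open>L\<close> is the double integral of the limit kernel against the limit measure.
\<close>
lemma variance_R_limit:
  assumes H: "0 < H" "H < 1"
    and h: "\<forall>x>0. 0 < h x" "slowly_varying h"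
    and var: "\<forall>n\<ge>1. variance (S_sum X n) = (h (real n))\<^sup>2 * real n powr (2 * H)"
    and \<nu>: "0 \<le> \<nu>" and M: "M \<in> R_class \<nu>" and r: "(\<lambda>n. M 0 / M (real n)) \<longlonglongrightarrow> r"
    and m: "\<And>N p. m N p = pow0 (real (Suc p) / real N) \<nu> - (if p = 0 then r else pow0 (real p / real N) \<nu>)"
    and lim: "(\<lambda>N. \<Sum>p<N. \<Sum>q<N. m N p * m N q * fbm_kernel H (real p / real N) (real q / real N)) \<longlonglongrightarrow> L"
    and L: "L \<noteq> 0"
  shows "(\<lambda>n. variance (R_sum X M n) / (L * (M (real n))\<^sup>2 * (h (real n))\<^sup>2 * real n powr (2 * H))) \<longlonglongrightarrow> 1"
proof -
  let ?V = "\<lambda>n. variance (S_sum X n)"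
  let ?w = "\<lambda>n i. Delta M i / M (real n)"
  let ?\<Phi> = "\<lambda>n i j. (?V (n - i) / ?V n + ?V (n - j) / ?V n - ?V (nat \<bar>int i - int j\<bar>) / ?V n) / 2"
  have normalise: "d / y * (e / y) * ((u / z + v / z - w / z) / 2) = d * e * ((u + v - w) / 2) / (y\<^sup>2 * z)"
    for d e u v w y z :: real
    by (simp add: power2_eq_square mult_ac flip: add_divide_distrib diff_divide_distrib)
  have Delta: "0 \<le> Delta M i" for i
    using mono_R_class[OF \<nu> M, of "real i" "real i + 1"] by (simp add: Delta_def)
  have "(\<lambda>n. \<Sum>i<n. \<Sum>j<n. ?w n i * ?w n j * ?\<Phi> n i j) \<longlonglongrightarrow> L"
  proof (rule block_double_sum_limit[where m = m and F = "fbm_kernel H"])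
    show "\<forall>\<^sub>F n in sequentially. \<forall>i<n. 0 \<le> ?w n i"
      using nonneg_R_class[OF M] Delta by (intro always_eventually) auto
    show "\<forall>\<^sub>F n in sequentially. (\<Sum>i<n. ?w n i) \<le> 1"
      using eventually_pos_R_class[OF \<nu> M]
    proof eventually_elim
      case (elim n)
      have "(\<Sum>i<n. Delta M i) = M (real n) - M 0"
        using sum_lessThan_telescope[of "\<lambda>i. M (real i)" n] by (simp add: Delta_def add.commute)
      also have "\<dots> \<le> M (real n)" using nonneg_R_class[OF M, of 0] by simp
      finally have "(\<Sum>i<n. Delta M i) / M (real n) \<le> 1" using elim by simp
      then show ?case by (simp only: sum_divide_distrib)
    qed
    show "\<forall>\<^sub>F n in sequentially. \<forall>i<n. \<forall>j<n. \<bar>?\<Phi> n i j - fbm_kernel H (real i / real n) (real j / real n)\<bar> \<le> \<epsilon>"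
      if "0 < \<epsilon>" for \<epsilon>
      using covariance_kernel_limit[of "\<lambda>n r. ?V r / ?V n", OF deviation_uniform_regular_variation[OF H h var] that] .
    show "uniformly_continuous_on ({0..1} \<times> {0..1}) (\<lambda>(s, t). fbm_kernel H s t)"
      using H by (intro compact_uniformly_continuous continuous_fbm_kernel compact_Times) auto
    show "(\<lambda>n. \<Sum>i\<in>{i\<in>{..<n}. i * N div n = p}. ?w n i) \<longlonglongrightarrow> m N p" if "0 < N" "p < N" for N p
      unfolding m using R_class_block_limit[OF \<nu> M that(2) r] .
  qed (rule lim)
  from tendsto_divide[OF this tendsto_const L]
  have "(\<lambda>n. (\<Sum>i<n. \<Sum>j<n. ?w n i * ?w n j * ?\<Phi> n i j) / L) \<longlonglongrightarrow> 1" using L by simp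
  moreover have "\<forall>\<^sub>F n in sequentially. (\<Sum>i<n. \<Sum>j<n. ?w n i * ?w n j * ?\<Phi> n i j) / L
      = variance (R_sum X M n) / (L * (M (real n))\<^sup>2 * (h (real n))\<^sup>2 * real n powr (2 * H))"
    using eventually_ge_at_top[of 1]
  proof eventually_elim
    case (elim n)
    have "(\<Sum>i<n. \<Sum>j<n. ?w n i * ?w n j * ?\<Phi> n i j) = variance (R_sum X M n) / ((M (real n))\<^sup>2 * ?V n)"
      unfolding variance_R sum_divide_distrib
      by (intro sum.cong refl normalise)
    then show ?case unfolding var[rule_format, OF elim] by (simp add: mult_ac)
  qed
  ultimately show ?thesis by (rule Lim_transform_eventually)
qed

end

theorem corollary1:
  fixes P :: "'a measure" and \<xi> :: "int \<Rightarrow> 'a \<Rightarrow> real" and a :: "int \<Rightarrow> real"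
    and X :: "int \<Rightarrow> 'a \<Rightarrow> real" and H :: real and h :: "real \<Rightarrow> real"
  assumes "prob_space P"
    and "prob_space.indep_vars P (\<lambda>_. borel) \<xi> UNIV"
    and "\<And>j k. distr P borel (\<xi> j) = distr P borel (\<xi> k)"
    and "\<And>k. integrable P (\<xi> k)"
    and "\<And>k. prob_space.expectation P (\<xi> k) = 0"
    and "\<And>k. prob_space.variance P (\<xi> k) = 1"
    and "(\<lambda>k. (a k)\<^sup>2) summable_on UNIV"
    and "\<And>j. has_L2_sum P (\<lambda>k \<omega>. a (j - k) * \<xi> k \<omega>) (X j) UNIV"
    and "0 < H" and "H < 1"
    and "\<And>x. 0 < x \<Longrightarrow> 0 < h x"
    and "slowly_varying h"
    and "\<And>n::nat. 1 \<le> n \<Longrightarrow>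
           prob_space.variance P (S_sum X n) = (h (real n))\<^sup>2 * real n powr (2 * H)"
  shows "(\<forall>\<nu>>0. \<forall>M\<in>R_class \<nu>. \<forall>(Q :: 'b measure) B. fractional_brownian_motion H Q B \<longrightarrow>
            (\<lambda>n. prob_space.variance P (R_sum X M n) /
                 (prob_space.variance Q (Z_proc \<nu> B 1) *
                  (M (real n))\<^sup>2 * (h (real n))\<^sup>2 * real n powr (2 * H))) \<longlonglongrightarrow> 1)
       \<and> (\<forall>M\<in>R_class 0.
            (\<lambda>n. prob_space.variance P (R_sum X M n) /
                 ((1 - end_ratio M)\<^sup>2 *
                  (M (real n))\<^sup>2 * (h (real n))\<^sup>2 * real n powr (2 * H))) \<longlonglongrightarrow> 1)"
proof -
  interpret centered_stationary P X
    by (rule linear_process_centered_stationary[OF assms(1,2,4-6,8)])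
  have pos: "\<forall>x>0. 0 < h x" using assms(11) by blast
  have var: "\<forall>n\<ge>1. variance (S_sum X n) = (h (real n))\<^sup>2 * real n powr (2 * H)"
    using assms(13) by blast
  note R_limit = variance_R_limit[OF assms(9,10) pos assms(12) var]
  show ?thesis
  proof (intro conjI allI ballI impI)
    fix \<nu> :: real and M B and Q :: "'b measure"
    assume \<nu>: "0 < \<nu>" and M: "M \<in> R_class \<nu>" and fbm: "fractional_brownian_motion H Q B"
    \<comment> \<open>the power vanishes at 0, so no mass is left over in block 0\<close>
    have "M 0 = 0" using M \<nu> by (auto simp: R_class_def pow0_def)
    then have r: "(\<lambda>n. M 0 / M (real n)) \<longlonglongrightarrow> 0" by simp
    show "(\<lambda>n. variance (R_sum X M n) / (prob_space.variance Q (Z_proc \<nu> B 1) *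
        (M (real n))\<^sup>2 * (h (real n))\<^sup>2 * real n powr (2 * H))) \<longlonglongrightarrow> 1"
      unfolding variance_Z_proc[OF fbm \<nu> assms(9)]
    proof (rule R_limit[OF less_imp_le[OF \<nu>] M r])
      show "(real (Suc p) / real N) powr \<nu> - (real p / real N) powr \<nu>
          = pow0 (real (Suc p) / real N) \<nu> - (if p = 0 then 0 else pow0 (real p / real N) \<nu>)" for N p
        using \<nu> by (simp add: pow0_def)
    qed (use power_law_block_sums[OF \<nu> assms(9)] integral_fbm_kernel_pos[OF \<nu> assms(9)] in auto)
  next
    fix M assume M: "M \<in> R_class 0"
    let ?c = "1 - end_ratio M"
    show "(\<lambda>n. variance (R_sum X M n) / (?c\<^sup>2 * (M (real n))\<^sup>2 * (h (real n))\<^sup>2 * real n powr (2 * H))) \<longlonglongrightarrow> 1"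
    proof (rule R_limit[OF order_refl M tendsto_end_ratio(1)[OF M]])
      show "(if p = 0 then ?c else 0) = pow0 (real (Suc p) / real N) 0
          - (if p = 0 then end_ratio M else pow0 (real p / real N) 0)" for N p
        by (simp add: pow0_def)
      have "(\<Sum>p<N. \<Sum>q<N. (if p = 0 then ?c else 0) * (if q = 0 then ?c else 0)
          * fbm_kernel H (real p / real N) (real q / real N)) = ?c\<^sup>2" if "1 \<le> N" for N
      proof -
        have summand: "(if p = 0 then ?c else 0) * (if q = 0 then ?c else 0) * fbm_kernel H (real p / real N) (real q / real N)
          = (?c\<^sup>2 * fbm_kernel H (real p / real N) (real q / real N)) * ((if p = 0 then 1 else 0) * (if q = 0 then 1 else 0))" for p q
          by (simp add: power2_eq_square)
        have "fbm_kernel H 0 0 = 1" by (simp add: fbm_kernel_def)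
        then show ?thesis
          unfolding summand
          using double_sum_delta[of 0 N 0 "\<lambda>p q. ?c\<^sup>2 * fbm_kernel H (real p / real N) (real q / real N)"] that
          by simp
      qed
      then show "(\<lambda>N. \<Sum>p<N. \<Sum>q<N. (if p = 0 then ?c else 0) * (if q = 0 then ?c else 0)
          * fbm_kernel H (real p / real N) (real q / real N)) \<longlonglongrightarrow> ?c\<^sup>2"
        by (intro tendsto_eventually eventually_sequentiallyI)
      show "?c\<^sup>2 \<noteq> 0" using tendsto_end_ratio(2)[OF M] by simp
    qed
  qed
qed


end
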